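(* Let $\varrho>0$. For every $f\in C_0[0,1]$, $$\lim_{n\to\infty}A_n^{\varrho}f=-A_{\varrho}^{-1}f,$$ uniformly on $[0,1]$.
   Context: $C[0,1]$ is the space of continuous real-valued functions on $[0,1]$ with sup norm $\|\cdot\|_\infty$. For $\varrho>0$ and an integer $n\ge 1$, the operator $U_n^{\varrho}$ on $C[0,1]$ is defined by $$U_n^{\varrho}(f,x)=f(0)(1-x)^n+f(1)x^n+\sum_{k=1}^{n-1}\left(\int_0^1\frac{t^{k\varrho-1}(1-t)^{(n-k)\varrho-1}}{B(k\varrho,(n-k)\varrho)}f(t)\,dt\right)p_{n,k}(x),$$ where $p_{n,k}(x)=\binom nk x^k(1-x)^{n-k}$ and $B(\cdot,\cdot)$ is Euler's Beta function. $C_0[0,1]:=\{f : f(x)=x(1-x)h(x),\ h\in C[0,1]\}$, with norm $\|f\|_0:=\|h\|_\infty$ for $f(x)=x(1-x)h(x)$; this is a Banach space. $U_n^{\varrho}$ maps $C_0[0,1]$ into itself with operator norm (with respect to $\|\cdot\|_0$) strictly less than $1$, so one may define $A_n^{\varrho}:C_0[0,1]\to C_0[0,1]$ by $$A_n^{\varrho}:=\frac{\varrho}{n\varrho+1}\sum_{k=0}^{\infty}(U_n^{\varrho})^k,\qquad n\ge1,$$ the series converging in operator norm on $(C_0[0,1],\|\cdot\|_0)$. $A_\varrho:\{y\in C^2[0,1] : y(0)=y(1)=0\}\to C_0[0,1]$ is the operator $A_\varrho y(x):=\frac{\varrho+1}{2\varrho}x(1-x)y''(x)$, which is bijective, and $A_\varrho^{-1}$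 is its inverse; explicitly, for $f(x)=x(1-x)h(x)$ with $h\in C[0,1]$, $$-A_\varrho^{-1}f(x)=\frac{2\varrho}{\varrho+1}\left[(1-x)\int_0^x t\,h(t)\,dt+x\int_x^1(1-t)h(t)\,dt\right].$$ *)

theory Defs
  imports "HOL-Analysis.Analysis"
begin

section \<open>The Banach space $C_0[0,1]$\<close>

text \<open>A function on $[0,1]$ is represented by a function on the reals that is zero outside
  $[0,1]$, so that equality in the type is equality on $[0,1]$.\<close>

definition zero_ext :: "(real \<Rightarrow> real) \<Rightarrow> real \<Rightarrow> real" where
  "zero_ext f = (\<lambda>x. if x \<in> {0..1} then f x else 0)"

typedef C0 = "{f :: real \<Rightarrow> real. (\<exists>h. continuous_on {0..1} h \<and> (\<forall>x\<in>{0..1}. f x = x * (1 - x) * h x))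
    \<and> (\<forall>x. x \<notin> {0..1} \<longrightarrow> f x = 0)}"
  morphisms apply_C0 Abs_C0
proof
  show "(\<lambda>_. 0) \<in> {f :: real \<Rightarrow> real. (\<exists>h. continuous_on {0..1} h \<and> (\<forall>x\<in>{0..1}. f x = x * (1 - x) * h x))
    \<and> (\<forall>x. x \<notin> {0..1} \<longrightarrow> f x = 0)}"
    by (auto intro!: exI[of _ "\<lambda>_. 0"])
qed

setup_lifting type_definition_C0

definition factor :: "C0 \<Rightarrow> real \<Rightarrow> real" where
  "factor f = (SOME h. continuous_on {0..1} h \<and> (\<forall>x\<in>{0..1}. apply_C0 f x = x * (1 - x) * h x))"

lemma factor: "continuous_on {0..1} (factor f)"
  "x \<in> {0..1} \<Longrightarrow> apply_C0 f x = x * (1 - x) * factor f x"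
proof -
  have "\<exists>h. continuous_on {0..1} h \<and> (\<forall>x\<in>{0..1}. apply_C0 f x = x * (1 - x) * h x)"
    using apply_C0[of f] by auto
  from someI_ex[OF this] show "continuous_on {0..1} (factor f)"
    "x \<in> {0..1} \<Longrightarrow> apply_C0 f x = x * (1 - x) * factor f x"
    by (auto simp: factor_def)
qed

lemma factor_unique:
  assumes "continuous_on {0..1} h" "\<And>x. x \<in> {0..1} \<Longrightarrow> apply_C0 f x = x * (1 - x) * h x"
    and x: "x \<in> {0..1}"
  shows "factor f x = h x"
proof -
  have cl: "closure {0<..<1::real} = {0..1}"
    by simp
  have eq: "factor f y - h y = 0" if y: "y \<in> {0<..<1}" for y
    using assms(2)[of y] factor(2)[of y f] y by auto
  have "factor f x - h x = 0"
  proof (rule continuous_constant_on_closure[of "{0<..<1}" "\<lambda>x. factor f x - h x" 0 x])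
    show "continuous_on (closure {0<..<1::real}) (\<lambda>x. factor f x - h x)"
      unfolding cl by (intro continuous_intros factor assms)
    show "x \<in> closure {0<..<1::real}" using x by (simp only: cl)
  qed (use eq in blast)
  then show ?thesis by simp
qed

lemma apply_C0_outside [simp]: "x \<notin> {0..1} \<Longrightarrow> apply_C0 f x = 0"
  using apply_C0[of f] by auto

lemma apply_Abs_C0:
  assumes "continuous_on {0..1} h" "\<And>x. x \<in> {0..1} \<Longrightarrow> f x = x * (1 - x) * h x"
  shows "apply_C0 (Abs_C0 (zero_ext f)) = zero_ext f"
  by (rule Abs_C0_inverse) (use assms in \<open>auto simp: zero_ext_def\<close>)

lemma factor_Abs_C0:
  assumes "continuous_on {0..1} h" "\<And>x. x \<in> {0..1} \<Longrightarrow> f x = x * (1 - x) * h x" "x \<in> {0..1}"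
  shows "factor (Abs_C0 (zero_ext f)) x = h x"
proof (rule factor_unique[OF assms(1) _ assms(3)])
  have "apply_C0 (Abs_C0 (zero_ext f)) = zero_ext f"
    using assms(1,2) by (rule apply_Abs_C0)
  then show "apply_C0 (Abs_C0 (zero_ext f)) y = y * (1 - y) * h y" if "y \<in> {0..1}" for y
    using that by (simp add: zero_ext_def assms(2))
qed

lemma C0_eqI: "(\<And>x. x \<in> {0..1} \<Longrightarrow> apply_C0 f x = apply_C0 g x) \<Longrightarrow> f = g"
  by (metis apply_C0_inject apply_C0_outside ext)

instantiation C0 :: real_vector
begin

lift_definition zero_C0 :: C0 is "\<lambda>_. 0"
  by (auto intro!: exI[of _ "\<lambda>_. 0"])

lift_definition plus_C0 :: "C0 \<Rightarrow> C0 \<Rightarrow> C0" is "\<lambda>f g x. f x + g x"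
proof (clarsimp, goal_cases)
  case (1 f g h k)
  then show ?case
    by (intro exI[of _ "\<lambda>x. h x + k x"]) (auto intro!: continuous_intros simp: algebra_simps)
qed

lift_definition uminus_C0 :: "C0 \<Rightarrow> C0" is "\<lambda>f x. - f x"
proof (clarsimp, goal_cases)
  case (1 f h)
  then show ?case
    by (intro exI[of _ "\<lambda>x. - h x"]) (auto intro!: continuous_intros simp: algebra_simps)
qed

lift_definition minus_C0 :: "C0 \<Rightarrow> C0 \<Rightarrow> C0" is "\<lambda>f g x. f x - g x"
proof (clarsimp, goal_cases)
  case (1 f g h k)
  then show ?case
    by (intro exI[of _ "\<lambda>x. h x - k x"]) (auto intro!: continuous_intros simp: algebra_simps)
qed

lift_definition scaleR_C0 :: "real \<Rightarrow> C0 \<Rightarrow> C0" is "\<lambda>c f x. c * f x"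
proof (clarsimp, goal_cases)
  case (1 c f h)
  then show ?case
    by (intro exI[of _ "\<lambda>x. c * h x"]) (auto intro!: continuous_intros simp: algebra_simps)
qed

instance
  by standard (transfer, simp add: algebra_simps fun_eq_iff)+

end

lemma factor_ops:
  assumes "x \<in> {0..1}"
  shows "factor 0 x = 0" "factor (f + g) x = factor f x + factor g x"
    "factor (f - g) x = factor f x - factor g x" "factor (c *\<^sub>R f) x = c * factor f x"
proof -
  show "factor 0 x = 0"
    by (rule factor_unique) (use assms in \<open>auto simp: zero_C0.rep_eq\<close>)
  show "factor (f + g) x = factor f x + factor g x"
    by (rule factor_unique)
      (use assms in \<open>auto intro!: continuous_intros factor(1) simp: plus_C0.rep_eq factor(2) algebra_simps\<close>)
  show "factor (f - g) x = factor f x - factor g x"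
    by (rule factor_unique)
      (use assms in \<open>auto intro!: continuous_intros factor(1) simp: minus_C0.rep_eq factor(2) algebra_simps\<close>)
  show "factor (c *\<^sub>R f) x = c * factor f x"
    by (rule factor_unique)
      (use assms in \<open>auto intro!: continuous_intros factor(1) simp: scaleR_C0.rep_eq factor(2) algebra_simps\<close>)
qed

instantiation C0 :: real_normed_vector
begin

definition norm_C0 :: "C0 \<Rightarrow> real" where
  "norm_C0 f = (SUP x\<in>{0..1}. \<bar>factor f x\<bar>)"

definition dist_C0 :: "C0 \<Rightarrow> C0 \<Rightarrow> real" where
  "dist_C0 f g = norm (f - g)"

definition sgn_C0 :: "C0 \<Rightarrow> C0" where
  "sgn_C0 f = f /\<^sub>R norm f"

definition uniformity_C0 :: "(C0 \<times> C0) filter" where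
  "uniformity_C0 = (INF e\<in>{0<..}. principal {(f, g). dist f g < e})"

definition open_C0 :: "C0 set \<Rightarrow> bool" where
  "open_C0 S \<longleftrightarrow> (\<forall>f\<in>S. \<forall>\<^sub>F (f', g) in uniformity. f' = f \<longrightarrow> g \<in> S)"

lemma factor_le_norm_C0:
  assumes "x \<in> {0..1}" shows "\<bar>factor f x\<bar> \<le> norm f"
  unfolding norm_C0_def
proof (rule cSUP_upper[OF assms])
  have "compact ((\<lambda>x. \<bar>factor f x\<bar>) ` {0..1})"
    by (intro compact_continuous_image continuous_intros factor(1)) simp
  then show "bdd_above ((\<lambda>x. \<bar>factor f x\<bar>) ` {0..1})"
    by (intro bounded_imp_bdd_above compact_imp_bounded)
qed

lemma norm_C0_le: "(\<And>x. x \<in> {0..1} \<Longrightarrow> \<bar>factor f x\<bar> \<le> b) \<Longrightarrow> norm f \<le> b"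
  unfolding norm_C0_def by (rule cSUP_least) auto

instance
proof
  fix f g :: C0 and c :: real
  show "dist f g = norm (f - g)" by (rule dist_C0_def)
  show "sgn f = f /\<^sub>R norm f" by (rule sgn_C0_def)
  show "uniformity = (INF e\<in>{0<..}. principal {(f, g :: C0). dist f g < e})"
    by (rule uniformity_C0_def)
  show "open S \<longleftrightarrow> (\<forall>f\<in>S. \<forall>\<^sub>F (f', g) in uniformity. f' = f \<longrightarrow> g \<in> S)" for S :: "C0 set"
    by (rule open_C0_def)
  show "norm f = 0 \<longleftrightarrow> f = 0"
  proof
    assume "norm f = 0"
    then have "factor f x = 0" if "x \<in> {0..1}" for x
      using factor_le_norm_C0[OF that, of f] by simp
    then show "f = 0"
      by (intro C0_eqI) (simp add: factor(2) zero_C0.rep_eq)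
  next
    assume "f = 0"
    then show "norm f = 0"
      using factor_ops(1) by (simp add: norm_C0_def)
  qed
  show "norm (f + g) \<le> norm f + norm g"
  proof (rule norm_C0_le)
    fix x :: real assume x: "x \<in> {0..1}"
    show "\<bar>factor (f + g) x\<bar> \<le> norm f + norm g"
      using factor_le_norm_C0[OF x, of f] factor_le_norm_C0[OF x, of g] factor_ops(2)[OF x, of f g]
      by linarith
  qed
  show "norm (c *\<^sub>R f) = \<bar>c\<bar> * norm f"
  proof (rule antisym)
    have le: "norm (a *\<^sub>R k) \<le> \<bar>a\<bar> * norm k" for a and k :: C0
      by (rule norm_C0_le) (auto simp: factor_ops abs_mult intro!: mult_left_mono factor_le_norm_C0)
    show "norm (c *\<^sub>R f) \<le> \<bar>c\<bar> * norm f"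
      by (rule le)
    show "\<bar>c\<bar> * norm f \<le> norm (c *\<^sub>R f)"
    proof (cases "c = 0")
      case True
      have "0 \<le> \<bar>factor (c *\<^sub>R f) 0\<bar>" by simp
      also have "\<dots> \<le> norm (c *\<^sub>R f)" by (rule factor_le_norm_C0) simp
      finally show ?thesis using True by simp
    next
      case False
      then have "norm f \<le> \<bar>inverse c\<bar> * norm (c *\<^sub>R f)"
        using le[of "inverse c" "c *\<^sub>R f"] by simp
      with False show ?thesis
        by (simp add: field_simps abs_inverse)
    qed
  qed
qed

end

instance C0 :: banach
proof
  fix X :: "nat \<Rightarrow> C0"
  assume X: "Cauchy X"
  define H where "H n x = factor (X n) x" for n x
  have fd: "\<bar>H m x - H n x\<bar> \<le> dist (X m) (X n)" if "x \<in> {0..1}" for m n x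
    using factor_le_norm_C0[OF that, of "X m - X n"] factor_ops(3)[OF that, of "X m" "X n"]
    by (simp add: H_def dist_norm)
  have "uniformly_Cauchy_on {0..1} H"
    unfolding uniformly_Cauchy_on_def
  proof (intro allI impI)
    fix e :: real assume "e > 0"
    with X obtain M where M: "\<And>m n. m \<ge> M \<Longrightarrow> n \<ge> M \<Longrightarrow> dist (X m) (X n) < e"
      unfolding Cauchy_def by blast
    show "\<exists>M. \<forall>x\<in>{0..1}. \<forall>m\<ge>M. \<forall>n\<ge>M. dist (H m x) (H n x) < e"
    proof (intro exI ballI allI impI)
      fix x :: real and m n assume "x \<in> {0..1}" "m \<ge> M" "n \<ge> M"
      then show "dist (H m x) (H n x) < e"
        using fd[of x m n] M[of m n] by (simp add: dist_real_def)
    qed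
  qed
  then obtain h where h: "uniform_limit {0..1} H h sequentially"
    using Cauchy_uniformly_convergent uniformly_convergent_on_def by blast
  have hc: "continuous_on {0..1} h"
    by (rule uniform_limit_theorem[OF _ h]) (auto simp: H_def[abs_def] factor(1))
  define f where "f = Abs_C0 (zero_ext (\<lambda>x. x * (1 - x) * h x))"
  have ff: "factor f x = h x" if "x \<in> {0..1}" for x
    unfolding f_def by (rule factor_Abs_C0[OF hc _ that]) simp
  have "X \<longlonglongrightarrow> f"
  proof (rule tendstoI)
    fix e :: real assume e: "e > 0"
    then have "\<forall>\<^sub>F n in sequentially. \<forall>x\<in>{0..1}. dist (H n x) (h x) < e / 2"
      by (intro uniform_limitD[OF h]) simp
    then show "\<forall>\<^sub>F n in sequentially. dist (X n) f < e"
    proof eventually_elim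
      case (elim n)
      have "norm (X n - f) \<le> e / 2"
      proof (rule norm_C0_le)
        fix x :: real assume x: "x \<in> {0..1}"
        with elim have "dist (H n x) (h x) < e / 2" by blast
        then show "\<bar>factor (X n - f) x\<bar> \<le> e / 2"
          using ff[OF x] factor_ops(3)[OF x, of "X n" f] by (simp add: H_def dist_real_def)
      qed
      with e show ?case by (simp add: dist_norm)
    qed
  qed
  then show "convergent X" by (auto simp: convergent_def)
qed


section \<open>The operators\<close>

definition U :: "real \<Rightarrow> nat \<Rightarrow> (real \<Rightarrow> real) \<Rightarrow> real \<Rightarrow> real" where
  "U \<rho> n f x = f 0 * (1 - x) ^ n + f 1 * x ^ n +
     (\<Sum>k = 1..n-1.
        integral {0..1} (\<lambda>t. t powr (real k * \<rho> - 1) * (1 - t) powr (real (n - k) * \<rho> - 1)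
                              / Beta (real k * \<rho>) (real (n - k) * \<rho>) * f t)
        * Bernstein n k x)"

text \<open>The restriction of $U$ to $C_0[0,1]$ as a bounded operator; the lemmas
  \<open>U_in_C0\<close> and \<open>bounded_linear_U\<close> below justify the two abstraction functions.\<close>

definition U_C0 :: "real \<Rightarrow> nat \<Rightarrow> C0 \<Rightarrow>\<^sub>L C0" where
  "U_C0 \<rho> n = Blinfun (\<lambda>f. Abs_C0 (zero_ext (U \<rho> n (apply_C0 f))))"

text \<open>The series converges in the operator norm, that is, in the type of bounded linear operators.\<close>

definition A_n :: "real \<Rightarrow> nat \<Rightarrow> C0 \<Rightarrow>\<^sub>L C0" where
  "A_n \<rho> n = (\<rho> / (real n * \<rho> + 1)) *\<^sub>R (\<Sum>k. (((o\<^sub>L) (U_C0 \<rho> n)) ^^ k) id_blinfun)"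

text \<open>The derivative of a function on $[0,1]$, one-sided at the end points.\<close>

definition deriv01 :: "(real \<Rightarrow> real) \<Rightarrow> real \<Rightarrow> real" where
  "deriv01 y x = vector_derivative y (at x within {0..1})"

definition C2_01 :: "(real \<Rightarrow> real) set" where
  "C2_01 = {y. (\<forall>x\<in>{0..1}. y differentiable (at x within {0..1}))
     \<and> (\<forall>x\<in>{0..1}. deriv01 y differentiable (at x within {0..1}))
     \<and> continuous_on {0..1} (deriv01 (deriv01 y))}"

definition A_dom :: "(real \<Rightarrow> real) set" where
  "A_dom = {y \<in> C2_01. y 0 = 0 \<and> y 1 = 0 \<and> (\<forall>x. x \<notin> {0..1} \<longrightarrow> y x = 0)}"

definition A_op :: "real \<Rightarrow> (real \<Rightarrow> real) \<Rightarrow> C0" where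
  "A_op \<rho> y = Abs_C0 (zero_ext (\<lambda>x. (\<rho> + 1) / (2 * \<rho>) * x * (1 - x) * deriv01 (deriv01 y) x))"

definition A_inv :: "real \<Rightarrow> C0 \<Rightarrow> real \<Rightarrow> real" where
  "A_inv \<rho> = the_inv_into A_dom (A_op \<rho>)"


subsection \<open>Well-definedness\<close>

definition U_coeff :: "real \<Rightarrow> nat \<Rightarrow> nat \<Rightarrow> (real \<Rightarrow> real) \<Rightarrow> real" where
  "U_coeff \<rho> n k f = integral {0..1} (\<lambda>t. t powr (real k * \<rho> - 1) * (1 - t) powr (real (n - k) * \<rho> - 1)
                              / Beta (real k * \<rho>) (real (n - k) * \<rho>) * f t)"

definition U_factor :: "real \<Rightarrow> nat \<Rightarrow> (real \<Rightarrow> real) \<Rightarrow> real \<Rightarrow> real" where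
  "U_factor \<rho> n f x = (\<Sum>k = 1..n-1. U_coeff \<rho> n k f * (real (n choose k) * x ^ (k - 1) * (1 - x) ^ (n - k - 1)))"

lemma U_eq_factor:
  assumes "f 0 = 0" "f 1 = 0"
  shows "U \<rho> n f x = x * (1 - x) * U_factor \<rho> n f x"
proof -
  have "Bernstein n k x = x * (1 - x) * (real (n choose k) * x ^ (k - 1) * (1 - x) ^ (n - k - 1))"
    if k: "k \<in> {1..n-1}" for k
  proof -
    define i j where "i = k - 1" and "j = n - k - 1"
    with k have ij: "k = Suc i" "n - k = Suc j" by auto
    have "n - k - 1 = j" "k - 1 = i" using ij by auto
    then show ?thesis by (simp only: Bernstein_def ij(2)) (simp add: ij(1))
  qed
  then show ?thesis
    unfolding U_def U_factor_def sum_distrib_left using assms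
    by (auto simp: U_coeff_def intro!: sum.cong)
qed

lemma continuous_U_factor: "continuous_on S (U_factor \<rho> n f)"
  unfolding U_factor_def by (intro continuous_intros)

lemma apply_C0_01 [simp]: "apply_C0 f 0 = 0" "apply_C0 f 1 = 0"
  using factor(2)[of 0 f] factor(2)[of 1 f] by auto

lemma continuous_apply_C0: "continuous_on {0..1} (apply_C0 f)"
proof -
  have "continuous_on {0..1} (\<lambda>x. x * (1 - x) * factor f x)"
    by (intro continuous_intros factor(1))
  then show ?thesis by (rule continuous_on_eq) (simp add: factor(2))
qed

lemma abs_apply_C0_le: "x \<in> {0..1} \<Longrightarrow> \<bar>apply_C0 f x\<bar> \<le> norm f"
proof -
  assume x: "x \<in> {0..1}"
  have "\<bar>x * (1 - x)\<bar> \<le> 1" using x by (auto simp: abs_mult intro!: mult_le_one)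
  then have "\<bar>x * (1 - x)\<bar> * \<bar>factor f x\<bar> \<le> 1 * norm f"
    by (intro mult_mono factor_le_norm_C0[OF x]) auto
  then show ?thesis by (simp add: factor(2)[OF x] abs_mult)
qed

lemma U_in_C0:
  "apply_C0 (Abs_C0 (zero_ext (U \<rho> n (apply_C0 f)))) = zero_ext (U \<rho> n (apply_C0 f))"
  by (rule apply_Abs_C0[OF continuous_U_factor[of _ \<rho> n "apply_C0 f"]]) (simp add: U_eq_factor)

lemma factor_U:
  "x \<in> {0..1} \<Longrightarrow> factor (Abs_C0 (zero_ext (U \<rho> n (apply_C0 f)))) x = U_factor \<rho> n (apply_C0 f) x"
  by (rule factor_Abs_C0[OF continuous_U_factor]) (simp_all add: U_eq_factor)

lemma kernel_integrable:
  fixes a b :: real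
  assumes "a > 0" "b > 0"
  shows "(\<lambda>t. t powr (a - 1) * (1 - t) powr (b - 1) / Beta a b * apply_C0 f t) integrable_on {0..1}"
proof -
  have B: "Beta a b > 0" using assms by (simp add: Beta_def Gamma_real_pos)
  have 1: "(\<lambda>t. t powr (a - 1) * (1 - t) powr (b - 1) / Beta a b) absolutely_integrable_on {0..1}"
    by (rule nonnegative_absolutely_integrable_1)
      (use assms B integrable_Beta'[OF assms] in \<open>auto intro!: integrable_on_divide\<close>)
  have "(\<lambda>t. apply_C0 f t * (t powr (a - 1) * (1 - t) powr (b - 1) / Beta a b)) absolutely_integrable_on {0..1}"
  proof (rule absolutely_integrable_bounded_measurable_product_real[OF _ _ _ 1])
    show "apply_C0 f \<in> borel_measurable (lebesgue_on {0..1})"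
      by (rule continuous_imp_measurable_on_sets_lebesgue[OF continuous_apply_C0]) simp
    show "bounded (apply_C0 f ` {0..1})"
      by (auto simp: bounded_iff intro!: exI[of _ "norm f"] abs_apply_C0_le)
  qed simp
  then show ?thesis
    by (subst mult.commute) (rule set_lebesgue_integral_eq_integral(1))
qed

lemma U_coeff_C0:
  assumes "\<rho> > 0" "k \<in> {1..n-1}"
  shows "U_coeff \<rho> n k (apply_C0 (f + g)) = U_coeff \<rho> n k (apply_C0 f) + U_coeff \<rho> n k (apply_C0 g)"
    and "U_coeff \<rho> n k (apply_C0 (c *\<^sub>R f)) = c * U_coeff \<rho> n k (apply_C0 f)"
    and "\<bar>U_coeff \<rho> n k (apply_C0 f)\<bar> \<le> norm f"
proof -
  define a b where "a = real k * \<rho>" and "b = real (n - k) * \<rho>"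
  have ab: "a > 0" "b > 0" using assms by (auto simp: a_def b_def)
  then have B: "Beta a b > 0" by (simp add: Beta_def Gamma_real_pos)
  define w where "w t = t powr (a - 1) * (1 - t) powr (b - 1) / Beta a b" for t
  have c: "U_coeff \<rho> n k f = integral {0..1} (\<lambda>t. w t * f t)" for f
    by (simp add: U_coeff_def w_def a_def b_def)
  have i: "(\<lambda>t. w t * apply_C0 f t) integrable_on {0..1}" for f
    unfolding w_def by (rule kernel_integrable[OF ab])
  have w: "(w has_integral 1) {0..1}"
    using has_integral_divide[OF has_integral_Beta_real[OF ab], of "Beta a b"] B by (simp add: w_def[abs_def])
  show "U_coeff \<rho> n k (apply_C0 (f + g)) = U_coeff \<rho> n k (apply_C0 f) + U_coeff \<rho> n k (apply_C0 g)"
    by (simp add: c plus_C0.rep_eq distrib_left integral_add[OF i i])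
  show "U_coeff \<rho> n k (apply_C0 (c *\<^sub>R f)) = c * U_coeff \<rho> n k (apply_C0 f)"
    by (simp add: c scaleR_C0.rep_eq mult.left_commute)
  have "norm (integral {0..1} (\<lambda>t. w t * apply_C0 f t)) \<le> integral {0..1} (\<lambda>t. w t * norm f)"
  proof (rule integral_norm_bound_integral[OF i])
    show "(\<lambda>t. w t * norm f) integrable_on {0..1}"
      using w by (intro integrable_on_mult_left) (auto simp: integrable_on_def)
    fix t :: real assume t: "t \<in> {0..1}"
    have "w t \<ge> 0" using B by (simp add: w_def)
    then show "norm (w t * apply_C0 f t) \<le> w t * norm f"
      using abs_apply_C0_le[OF t, of f] by (simp add: abs_mult mult_left_mono)
  qed
  then show "\<bar>U_coeff \<rho> n k (apply_C0 f)\<bar> \<le> norm f"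
    using w by (simp add: c integral_unique)
qed

lemma bounded_linear_U:
  assumes "\<rho> > 0"
  shows "bounded_linear (\<lambda>f. Abs_C0 (zero_ext (U \<rho> n (apply_C0 f))))" (is "bounded_linear ?T")
proof (rule bounded_linear_intro)
  show "?T (f + g) = ?T f + ?T g" for f g
    by (rule C0_eqI) (simp add: factor(2) factor_U factor_ops U_factor_def U_coeff_C0[OF assms]
        algebra_simps flip: sum.distrib)
  show "?T (c *\<^sub>R f) = c *\<^sub>R ?T f" for c f
    by (rule C0_eqI) (simp add: factor(2) factor_U factor_ops U_factor_def U_coeff_C0[OF assms]
        sum_distrib_left mult_ac)
  show "norm (?T f) \<le> norm f * (\<Sum>k = 1..n-1. real (n choose k))" for f
  proof (rule norm_C0_le)
    fix x :: real assume x: "x \<in> {0..1}"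
    have "\<bar>U_factor \<rho> n (apply_C0 f) x\<bar>
      \<le> (\<Sum>k = 1..n-1. norm f * (real (n choose k) * 1 * 1))"
      unfolding U_factor_def
    proof (rule order.trans[OF sum_abs], rule sum_mono)
      fix k assume k: "k \<in> {1..n-1}"
      have "real (n choose k) * x ^ (k - 1) * (1 - x) ^ (n - k - 1) \<le> real (n choose k) * 1 * 1"
        using x by (intro mult_mono power_le_one) auto
      then show "\<bar>U_coeff \<rho> n k (apply_C0 f) * (real (n choose k) * x ^ (k - 1) * (1 - x) ^ (n - k - 1))\<bar>
          \<le> norm f * (real (n choose k) * 1 * 1)"
        unfolding abs_mult[of "U_coeff \<rho> n k (apply_C0 f)"]
        using x by (intro mult_mono U_coeff_C0(3)[OF assms k]) auto
    qed
    then show "\<bar>factor (?T f) x\<bar> \<le> norm f * (\<Sum>k = 1..n-1. real (n choose k))"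
      by (simp add: factor_U[OF x] sum_distrib_left)
  qed
qed

lemma U_C0_apply:
  assumes "\<rho> > 0"
  shows "apply_C0 (blinfun_apply (U_C0 \<rho> n) f) = zero_ext (U \<rho> n (apply_C0 f))"
  unfolding U_C0_def by (simp add: bounded_linear_Blinfun_apply[OF bounded_linear_U[OF assms]] U_in_C0)

lemma A_op_apply:
  assumes "y \<in> A_dom"
  shows "apply_C0 (A_op \<rho> y) = zero_ext (\<lambda>x. (\<rho> + 1) / (2 * \<rho>) * x * (1 - x) * deriv01 (deriv01 y) x)"
  unfolding A_op_def
proof (rule apply_Abs_C0)
  show "continuous_on {0..1} (\<lambda>x. (\<rho> + 1) / (2 * \<rho>) * deriv01 (deriv01 y) x)"
    using assms by (intro continuous_on_mult_left) (simp add: A_dom_def C2_01_def)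
qed (simp add: mult_ac)

end

theory Submission
  imports Defs "HOL-Real_Asymp.Real_Asymp"
begin

text \<open>
  Put $\varphi(x) = x(1-x)$. Since $U_n^\varrho$ is positive and maps $\varphi$ to
  $\bigl(1 - \frac{\varrho+1}{n\varrho+1}\bigr)\varphi$, summing a geometric series gives
  $\|A_n^\varrho\| \le \frac{\varrho}{\varrho+1}$ on $C_0[0,1]$, uniformly in $n$. For $y$ in the domain of $A_\varrho$,
  the second central moment of $U_n^\varrho$ is a multiple of $\varphi/(n\varrho+1)$ and the fourth is
  $O(\varphi/n^2)$, so Voronovskaja's formula
  $\frac{n\varrho+1}{\varrho}(U_n^\varrho y - y) \to A_\varrho y$ holds in the norm of $C_0[0,1]$. Applying $A_n^\varrho$, which
  inverts $\frac{n\varrho+1}{\varrho}(I - U_n^\varrho)$, yields $A_n^\varrho A_\varrho y \to -y$ in that norm; injectivity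
  of $A_\varrho$ is then the uniqueness of limits.
\<close>

subsection \<open>Central moments of the Bernstein basis\<close>

text \<open>Pascal's rule. It covers \<open>k = n\<close>, where the last term vanishes with its
  binomial coefficient.\<close>

lemma Bernstein_Suc_Suc:
  assumes "k \<le> n"
  shows "Bernstein (Suc n) (Suc k) x = x * Bernstein n k x + (1 - x) * Bernstein n (Suc k) x"
proof (cases "k = n")
  case True
  then show ?thesis by (simp add: Bernstein_def)
next
  case False
  with assms have "n - k = Suc (n - Suc k)" by simp
  then show ?thesis by (simp add: Bernstein_def algebra_simps)
qed

text \<open>A binomial variable for n + 1 trials is one for n trials plus an independent Bernoulli
  variable; the right-hand side conditions on the outcome of the extra trial.\<close>

lemma sum_Bernstein_Suc:
  "(\<Sum>k\<le>Suc n. g k * Bernstein (Suc n) k x) =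
     x * (\<Sum>k\<le>n. g (Suc k) * Bernstein n k x) + (1 - x) * (\<Sum>k\<le>n. g k * Bernstein n k x)"
proof -
  have "(\<Sum>k\<le>Suc n. g k * Bernstein (Suc n) k x) =
      g 0 * Bernstein (Suc n) 0 x + (\<Sum>k\<le>n. g (Suc k) * Bernstein (Suc n) (Suc k) x)"
    by (rule sum.atMost_Suc_shift)
  also have "(\<Sum>k\<le>n. g (Suc k) * Bernstein (Suc n) (Suc k) x) =
      x * (\<Sum>k\<le>n. g (Suc k) * Bernstein n k x) + (1 - x) * (\<Sum>k\<le>n. g (Suc k) * Bernstein n (Suc k) x)"
    by (simp add: Bernstein_Suc_Suc sum_distrib_left algebra_simps flip: sum.distrib sum_subtractf)
  also have "g 0 * Bernstein (Suc n) 0 x = (1 - x) * (g 0 * Bernstein n 0 x)"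
    by (simp add: Bernstein_def)
  also have "(1 - x) * (g 0 * Bernstein n 0 x) + (x * (\<Sum>k\<le>n. g (Suc k) * Bernstein n k x)
        + (1 - x) * (\<Sum>k\<le>n. g (Suc k) * Bernstein n (Suc k) x)) =
      x * (\<Sum>k\<le>n. g (Suc k) * Bernstein n k x) + (1 - x) * (\<Sum>k\<le>Suc n. g k * Bernstein n k x)"
    by (simp only: sum.atMost_Suc_shift distrib_left ac_simps)
  also have "(\<Sum>k\<le>Suc n. g k * Bernstein n k x) = (\<Sum>k\<le>n. g k * Bernstein n k x)"
    by (simp add: Bernstein_def)
  finally show ?thesis .
qed

text \<open>A success moves the deviation from the mean by \<open>1 - x\<close>, a failure by
  \<open>- x\<close>. With a power for \<open>g\<close> this is a recursion in n for the central
  moments.\<close>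

lemma sum_Bernstein_Suc_central:
  "(\<Sum>k\<le>Suc n. g (real k - real (Suc n) * x) * Bernstein (Suc n) k x) =
     (\<Sum>k\<le>n. (x * g (real k - real n * x + (1 - x)) + (1 - x) * g (real k - real n * x - x)) * Bernstein n k x)"
proof -
  have "(\<Sum>k\<le>Suc n. g (real k - real (Suc n) * x) * Bernstein (Suc n) k x) =
      x * (\<Sum>k\<le>n. g (real k - real n * x + (1 - x)) * Bernstein n k x)
      + (1 - x) * (\<Sum>k\<le>n. g (real k - real n * x - x) * Bernstein n k x)"
    by (subst sum_Bernstein_Suc) (simp add: algebra_simps)
  also have "\<dots> = (\<Sum>k\<le>n. (x * g (real k - real n * x + (1 - x)) + (1 - x) * g (real k - real n * x - x)) * Bernstein n k x)"
    by (simp add: sum_distrib_left distrib_right mult.assoc sum.distrib)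
  finally show ?thesis .
qed

lemma Bernstein_central_moment1: "(\<Sum>k\<le>n. (real k - real n * x) * Bernstein n k x) = 0"
  using sum_k_Bernstein[of n x]
  by (simp add: left_diff_distrib sum_subtractf flip: sum_distrib_left)

lemma Bernstein_central_moment2:
  "(\<Sum>k\<le>n. (real k - real n * x)\<^sup>2 * Bernstein n k x) = real n * (x * (1 - x))"
proof (induction n)
  case 0
  then show ?case by (simp add: Bernstein_def)
next
  case (Suc n)
  have "x * (d + (1 - x))\<^sup>2 + (1 - x) * (d - x)\<^sup>2 = d\<^sup>2 + x * (1 - x)" for d
    by algebra
  then show ?case
    unfolding sum_Bernstein_Suc_central[of "\<lambda>d. d\<^sup>2"]
    by (simp add: distrib_right[of _ "x * (1 - x)"] sum.distrib Suc.IH flip: sum_distrib_left)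
      (simp add: algebra_simps)
qed

text \<open>The Bernoulli increment has mean 0, so the expanded fourth power has no cubic term and
  the third moment never enters; the linear term drops out because the first central moment is
  0.\<close>

lemma Bernstein_central_moment4:
  "(\<Sum>k\<le>n. (real k - real n * x) ^ 4 * Bernstein n k x) =
     3 * (x * (1 - x))\<^sup>2 * (real n * (real n - 1)) + real n * (x * (1 - x)) * (1 - 3 * (x * (1 - x)))"
proof (induction n)
  case 0
  then show ?case by (simp add: Bernstein_def)
next
  case (Suc n)
  define \<phi> where "\<phi> = x * (1 - x)"
  define c where "c = 4 * \<phi> * (1 - 2 * x)"
  have "x * (d + (1 - x)) ^ 4 + (1 - x) * (d - x) ^ 4
      = d ^ 4 + 6 * \<phi> * d\<^sup>2 + c * d + \<phi> * (1 - 3 * \<phi>)" for d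
    unfolding \<phi>_def c_def by algebra
  then have "(\<Sum>k\<le>Suc n. (real k - real (Suc n) * x) ^ 4 * Bernstein (Suc n) k x) =
      (\<Sum>k\<le>n. (real k - real n * x) ^ 4 * Bernstein n k x)
      + 6 * \<phi> * (\<Sum>k\<le>n. (real k - real n * x)\<^sup>2 * Bernstein n k x)
      + c * (\<Sum>k\<le>n. (real k - real n * x) * Bernstein n k x) + \<phi> * (1 - 3 * \<phi>) * (\<Sum>k\<le>n. Bernstein n k x)"
    unfolding sum_Bernstein_Suc_central[of "\<lambda>d. d ^ 4"]
    by (simp add: distrib_right[of _ _ "Bernstein _ _ _"] sum.distrib mult.assoc del: sum_Bernstein flip: sum_distrib_left)
  also have "\<dots> = 3 * \<phi>\<^sup>2 * (real (Suc n) * (real (Suc n) - 1)) + real (Suc n) * \<phi> * (1 - 3 * \<phi>)"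
    unfolding Suc.IH Bernstein_central_moment1 Bernstein_central_moment2 sum_Bernstein \<phi>_def[symmetric]
    by (simp add: algebra_simps power2_eq_square)
  finally show ?case by (simp add: \<phi>_def)
qed

text \<open>One factor \<open>x * (1 - x)\<close> is kept in the bound because the norm of
  \<open>C0\<close> divides by it.\<close>

lemma Bernstein_central_moment4_le:
  assumes "x \<in> {0..1}"
  shows "(\<Sum>k\<le>n. (real k - real n * x) ^ 4 * Bernstein n k x) \<le> x * (1 - x) * (real n)\<^sup>2"
proof (cases "n = 0")
  case True
  then show ?thesis by (simp add: Bernstein_def)
next
  case False
  define \<phi> where "\<phi> = x * (1 - x)"
  have \<phi>: "0 \<le> \<phi>" using assms by (simp add: \<phi>_def)
  have "0 \<le> (1 - 2 * x)\<^sup>2" by simp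
  then have "4 * \<phi> \<le> 1" by (simp add: \<phi>_def power2_eq_square algebra_simps)
  \<comment> \<open>This is the right-hand side of the claim minus the left-hand side, with \<phi>
    \<le> 1/4 giving the sign of \<open>1 - 3 * \<phi>\<close>.\<close>
  then have "0 \<le> \<phi> * (real n - 1) * real n * (1 - 3 * \<phi>) + 3 * \<phi>\<^sup>2 * real n"
    using \<phi> False by (intro add_nonneg_nonneg mult_nonneg_nonneg) auto
  then show ?thesis
    unfolding Bernstein_central_moment4 \<phi>_def[symmetric]
    by (simp add: algebra_simps power2_eq_square)
qed

section \<open>Moments of the nodes k/n under the Bernstein weights\<close>

context
  fixes n :: nat
  assumes n: "n \<ge> 1"
begin

lemma Bernstein_scaled_mean: "(\<Sum>k\<le>n. (real k / real n - x) * Bernstein n k x) = 0"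
proof -
  have "(\<Sum>k\<le>n. (real k / real n - x) * Bernstein n k x) =
      (\<Sum>k\<le>n. (real k - real n * x) * Bernstein n k x) / real n"
    using n by (simp add: sum_divide_distrib diff_divide_distrib left_diff_distrib)
  then show ?thesis by (simp only: Bernstein_central_moment1 div_0)
qed

lemma Bernstein_scaled_power:
  "(\<Sum>k\<le>n. (real k / real n - x) ^ j * Bernstein n k x) =
     (\<Sum>k\<le>n. (real k - real n * x) ^ j * Bernstein n k x) / real n ^ j"
proof -
  have "real k / real n - x = (real k - real n * x) / real n" for k
    using n by (simp add: field_simps)
  then show ?thesis
    by (simp add: sum_divide_distrib power_divide)
qed

lemma Bernstein_scaled_variance:
  "(\<Sum>k\<le>n. (real k / real n - x)\<^sup>2 * Bernstein n k x) = x * (1 - x) / real n"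
  unfolding Bernstein_scaled_power Bernstein_central_moment2 using n by (simp add: power2_eq_square)

text \<open>Expanding \<open>m * (1 - m)\<close> around x reduces the sum to the mean and variance
  of the nodes. It serves to average the variances of the Beta distributions over k.\<close>

lemma sum_Bernstein_phi:
  "(\<Sum>k\<le>n. real k / real n * (1 - real k / real n) * Bernstein n k x) = x * (1 - x) * (1 - 1 / real n)"
proof -
  have "(\<Sum>k\<le>n. real k / real n * (1 - real k / real n) * Bernstein n k x) =
      (\<Sum>k\<le>n. x * (1 - x) * Bernstein n k x + (1 - 2 * x) * ((real k / real n - x) * Bernstein n k x)
        - (real k / real n - x)\<^sup>2 * Bernstein n k x)"
  proof (rule sum.cong[OF refl])
    have "m * (1 - m) * p = x * (1 - x) * p + (1 - 2 * x) * ((m - x) * p) - (m - x)\<^sup>2 * p" for m p :: real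
      by algebra
    then show "real k / real n * (1 - real k / real n) * Bernstein n k x =
        x * (1 - x) * Bernstein n k x + (1 - 2 * x) * ((real k / real n - x) * Bernstein n k x)
        - (real k / real n - x)\<^sup>2 * Bernstein n k x" for k .
  qed
  also have "\<dots> = x * (1 - x) * (\<Sum>k\<le>n. Bernstein n k x)
      + (1 - 2 * x) * (\<Sum>k\<le>n. (real k / real n - x) * Bernstein n k x)
      - (\<Sum>k\<le>n. (real k / real n - x)\<^sup>2 * Bernstein n k x)"
    by (simp only: sum.distrib sum_subtractf sum_distrib_left)
  also have "\<dots> = x * (1 - x) * (1 - 1 / real n)"
    by (simp only: Bernstein_scaled_mean Bernstein_scaled_variance sum_Bernstein) (simp add: right_diff_distrib)
  finally show ?thesis .
qed

end

subsection \<open>The functionals of the operator U\<close>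

definition Beta_density :: "real \<Rightarrow> real \<Rightarrow> real \<Rightarrow> real" where
  "Beta_density a b t = t powr (a - 1) * (1 - t) powr (b - 1) / Beta a b"

lemma Beta_pos: "a > 0 \<Longrightarrow> b > 0 \<Longrightarrow> Beta a (b :: real) > 0"
  by (simp add: Beta_def Gamma_real_pos)

lemma Beta_density_nonneg: "a > 0 \<Longrightarrow> b > 0 \<Longrightarrow> Beta_density a b t \<ge> 0"
  using Beta_pos[of a b] by (simp add: Beta_density_def)

lemma Beta_density_times_continuous_integrable:
  fixes a b :: real
  assumes "a > 0" "b > 0" "continuous_on {0..1} g"
  shows "(\<lambda>t. Beta_density a b t * g t) integrable_on {0..1}"
proof -
  have 1: "Beta_density a b absolutely_integrable_on {0..1}"
    by (rule nonnegative_absolutely_integrable_1)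
      (use assms Beta_density_nonneg integrable_Beta'[OF assms(1,2)] in
        \<open>auto simp: Beta_density_def[abs_def] intro!: integrable_on_divide\<close>)
  have "(\<lambda>t. g t * Beta_density a b t) absolutely_integrable_on {0..1}"
  proof (rule absolutely_integrable_bounded_measurable_product_real[OF _ _ _ 1])
    show "g \<in> borel_measurable (lebesgue_on {0..1})"
      by (rule continuous_imp_measurable_on_sets_lebesgue[OF assms(3)]) simp
    show "bounded (g ` {0..1})"
      by (intro compact_imp_bounded compact_continuous_image assms) simp
  qed simp
  then show ?thesis
    by (subst mult.commute) (rule set_lebesgue_integral_eq_integral(1))
qed

text \<open>Iterates the functional equation
  \<open>(a + b) * Beta (a + 1) b = a * Beta a b\<close>.\<close>

lemma Beta_add_nat_left:
  assumes "a > 0" "b > (0 :: real)"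
  shows "Beta (a + real j) b = Beta a b * pochhammer a j / pochhammer (a + b) j"
proof (induction j)
  case (Suc j)
  have "a + real j \<notin> \<int>\<^sub>\<le>\<^sub>0"
    using assms by (auto simp: nonpos_Ints_def)
  from Beta_plus1_left[OF this, of b]
  have "(a + b + real j) * Beta (a + real (Suc j)) b = (a + real j) * Beta (a + real j) b"
    by (simp add: algebra_simps)
  moreover have "a + b + real j > 0"
    using assms by (intro add_pos_nonneg) auto
  ultimately have "Beta (a + real (Suc j)) b = Beta (a + real j) b * (a + real j) / (a + b + real j)"
    by (simp add: eq_divide_eq mult.commute)
  then show ?case
    by (simp add: Suc.IH pochhammer_Suc)
qed simp

lemma has_integral_Beta_density_power:
  assumes "a > 0" "b > 0"
  shows "((\<lambda>t. Beta_density a b t * t ^ j) has_integral pochhammer a j / pochhammer (a + b) j) {0..1}"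
proof -
  have "((\<lambda>t. t powr (a + real j - 1) * (1 - t) powr (b - 1) / Beta a b)
      has_integral Beta (a + real j) b / Beta a b) {0..1}"
    using assms by (intro has_integral_divide has_integral_Beta_real) auto
  moreover have "t powr (a + real j - 1) * (1 - t) powr (b - 1) / Beta a b = Beta_density a b t * t ^ j"
    if "t \<in> {0..1}" for t
  \<comment> \<open>Since \<open>0 powr c = 0\<close> for every c, \<open>t ^ 0\<close> is not
    \<open>t powr 0\<close> at \<open>t = 0\<close>; there both sides vanish because of the
    \<open>powr\<close> factor.\<close>
  proof (cases "t = 0")
    case False
    with that have "t powr (a + real j - 1) = t powr (a - 1) * t ^ j"
      by (simp add: flip: powr_add powr_realpow) (simp add: algebra_simps)
    then show ?thesis by (simp add: Beta_density_def)
  qed (simp add: Beta_density_def)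
  moreover have "Beta (a + real j) b / Beta a b = pochhammer a j / pochhammer (a + b) j"
    using Beta_pos[OF assms] by (simp add: Beta_add_nat_left[OF assms])
  ultimately show ?thesis
    by (metis (no_types, lifting) has_integral_cong)
qed

text \<open>The boundary terms of $U_n^\varrho$ are treated as the degenerate cases $k = 0, n$ of the
  Beta functionals, so that the formula for the moments holds for all $k \le n$.\<close>
definition U_functional :: "real \<Rightarrow> nat \<Rightarrow> nat \<Rightarrow> (real \<Rightarrow> real) \<Rightarrow> real" where
  "U_functional \<rho> n k f = (if k = 0 then f 0 else if k = n then f 1 else U_coeff \<rho> n k f)"

lemma U_coeff_eq_integral:
  "U_coeff \<rho> n k f = integral {0..1} (\<lambda>t. Beta_density (real k * \<rho>) (real (n - k) * \<rho>) t * f t)"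
  by (simp add: U_coeff_def Beta_density_def)

text \<open>With \<open>n \<ge> 1\<close> the indices 0 and n are distinct, so each boundary term of
  U is exactly one summand.\<close>

lemma U_eq_sum_functional:
  assumes "n \<ge> 1"
  shows "U \<rho> n f x = (\<Sum>k\<le>n. U_functional \<rho> n k f * Bernstein n k x)"
proof -
  have "{..n} = insert 0 (insert n {1..n-1})"
    using assms by auto
  moreover have "(\<Sum>k = 1..n-1. U_functional \<rho> n k f * Bernstein n k x) =
      (\<Sum>k = 1..n-1. U_coeff \<rho> n k f * Bernstein n k x)"
    by (intro sum.cong) (auto simp: U_functional_def)
  ultimately show ?thesis
    using assms by (simp add: U_def U_coeff_def) (simp add: U_functional_def Bernstein_def)
qed

section \<open>Linearity, positivity and moments of the functional for a fixed index k\<close>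

context
  fixes \<rho> :: real and n k :: nat
  assumes \<rho>: "\<rho> > 0" and n: "n \<ge> 1" and k: "k \<le> n"
begin

lemma Beta_density_interior_integrable:
  assumes "k \<noteq> 0" "k \<noteq> n" "continuous_on {0..1} f"
  shows "(\<lambda>t. Beta_density (real k * \<rho>) (real (n - k) * \<rho>) t * f t) integrable_on {0..1}"
  using assms k \<rho> by (intro Beta_density_times_continuous_integrable) auto

lemma U_functional_add:
  assumes "continuous_on {0..1} f" "continuous_on {0..1} g"
  shows "U_functional \<rho> n k (\<lambda>t. f t + g t) = U_functional \<rho> n k f + U_functional \<rho> n k g"
  using Beta_density_interior_integrable assms
  by (simp add: U_functional_def U_coeff_eq_integral distrib_left integral_add)

lemma U_functional_cmult: "U_functional \<rho> n k (\<lambda>t. c * f t) = c * U_functional \<rho> n k f"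
  by (simp add: U_functional_def U_coeff_eq_integral mult.left_commute)

lemma U_functional_mono:
  assumes "continuous_on {0..1} f" "continuous_on {0..1} g" "\<And>t. t \<in> {0..1} \<Longrightarrow> f t \<le> g t"
  shows "U_functional \<rho> n k f \<le> U_functional \<rho> n k g"
proof -
  have "U_coeff \<rho> n k f \<le> U_coeff \<rho> n k g" if "k \<noteq> 0" "k \<noteq> n"
    unfolding U_coeff_eq_integral using that assms \<rho> k
    by (intro integral_le Beta_density_interior_integrable mult_left_mono Beta_density_nonneg) auto
  then show ?thesis using assms(3) by (auto simp: U_functional_def)
qed

lemma U_functional_sum:
  assumes "finite I" "\<And>i. i \<in> I \<Longrightarrow> continuous_on {0..1} (f i)"
  shows "U_functional \<rho> n k (\<lambda>t. \<Sum>i\<in>I. f i t) = (\<Sum>i\<in>I. U_functional \<rho> n k (f i))"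
  using assms
proof (induction I rule: finite_induct)
  case empty
  show ?case using U_functional_cmult[of 0 "\<lambda>_. 0"] by simp
next
  case (insert i I)
  then show ?case by (simp add: U_functional_add continuous_on_sum)
qed

text \<open>At \<open>k = 0\<close> the numerator is 1 for \<open>j = 0\<close> and 0 otherwise,
  which is \<open>0 ^ j\<close>; at \<open>k = n\<close> the quotient is 1. Other k give the moments
  of a Beta distribution.\<close>

lemma U_functional_power:
  "U_functional \<rho> n k (\<lambda>t. t ^ j) = pochhammer (real k * \<rho>) j / pochhammer (real n * \<rho>) j"
proof -
  consider "k = 0" | "k = n" | "0 < k" "k < n" using k by linarith
  then show ?thesis
  proof cases
    case 1
    then show ?thesis by (cases j) (auto simp: U_functional_def pochhammer_rec)
  next
    case 2
    moreover have "pochhammer (real n * \<rho>) j > 0"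
      using \<rho> n by (intro pochhammer_pos) auto
    ultimately show ?thesis using n by (simp add: U_functional_def)
  next
    case 3
    have "real k * \<rho> + real (n - k) * \<rho> = real n * \<rho>"
      using 3 by (simp add: of_nat_diff algebra_simps)
    with has_integral_Beta_density_power[of "real k * \<rho>" "real (n - k) * \<rho>" j] 3 \<rho> show ?thesis
      by (simp add: U_functional_def U_coeff_eq_integral integral_unique)
  qed
qed

lemma U_functional_polynomial:
  "U_functional \<rho> n k (\<lambda>t. \<Sum>j\<le>d. c j * t ^ j) =
     (\<Sum>j\<le>d. c j * (pochhammer (real k * \<rho>) j / pochhammer (real n * \<rho>) j))"
  by (subst U_functional_sum) (auto simp: U_functional_cmult U_functional_power intro!: continuous_intros)

text \<open>The functional is a Beta distribution, a point mass if \<open>k = 0\<close> or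
  \<open>k = n\<close>, with mean m and variance \<open>m * (1 - m) / (real n * \<rho> + 1)\<close>;
  the formula is squared bias plus variance.\<close>

lemma U_functional_square:
  defines "m \<equiv> real k / real n"
  shows "U_functional \<rho> n k (\<lambda>t. (t - x)\<^sup>2) = (m - x)\<^sup>2 + m * (1 - m) / (real n * \<rho> + 1)"
proof -
  define N where "N = real n * \<rho>"
  have N: "N > 0" using \<rho> n by (simp add: N_def)
  have km: "real k * \<rho> = m * N" using n by (simp add: m_def N_def)
  define c where "c j = (if j = 0 then x\<^sup>2 else if j = 1 then - 2 * x else 1)" for j :: nat
  have "U_functional \<rho> n k (\<lambda>t. \<Sum>j\<le>2. c j * t ^ j) =
      (\<Sum>j\<le>2. c j * (pochhammer (m * N) j / pochhammer N j))"
    using U_functional_polynomial[of c 2] by (simp only: km N_def[symmetric])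
  moreover have "(\<lambda>t. \<Sum>j\<le>2. c j * t ^ j) = (\<lambda>t. (t - x)\<^sup>2)"
    by (simp add: c_def numeral_2_eq_2 fun_eq_iff algebra_simps)
  moreover have "(\<Sum>j\<le>2. c j * (pochhammer (m * N) j / pochhammer N j)) = (m - x)\<^sup>2 + m * (1 - m) / (N + 1)"
    using N by (simp add: c_def eval_nat_numeral pochhammer_Suc divide_simps add_pos_pos) algebra
  ultimately show ?thesis by (simp add: N_def)
qed

lemma U_functional_central4_le:
  defines "m \<equiv> real k / real n"
  shows "U_functional \<rho> n k (\<lambda>t. (t - m) ^ 4) \<le> 3 * (m * (1 - m)) / (real n * \<rho> + 1)\<^sup>2"
proof -
  define N where "N = real n * \<rho>"
  have N: "N > 0" using \<rho> n by (simp add: N_def)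
  have km: "real k * \<rho> = m * N" using n by (simp add: m_def N_def)
  have m: "0 \<le> m" "m \<le> 1" using k n by (auto simp: m_def)
  define p where "p = m * (1 - m)"
  have p: "0 \<le> p" using m by (simp add: p_def)
  have "0 \<le> (1 - 2 * m)\<^sup>2" by simp
  then have p4: "4 * p \<le> 1" by (simp add: p_def power2_eq_square algebra_simps)
  define c where "c j = (if j = 0 then m ^ 4 else if j = 1 then - 4 * m ^ 3
      else if j = 2 then 6 * m\<^sup>2 else if j = 3 then - 4 * m else 1)" for j :: nat
  have "U_functional \<rho> n k (\<lambda>t. \<Sum>j\<le>4. c j * t ^ j) =
      (\<Sum>j\<le>4. c j * (pochhammer (m * N) j / pochhammer N j))"
    using U_functional_polynomial[of c 4] by (simp only: km N_def[symmetric])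
  moreover have "(\<lambda>t. \<Sum>j\<le>4. c j * t ^ j) = (\<lambda>t. (t - m) ^ 4)"
    by (simp add: c_def eval_nat_numeral fun_eq_iff algebra_simps)
  \<comment> \<open>Closed form of the fourth central moment of the Beta distribution with
    parameters \<open>m * N\<close> and \<open>(1 - m) * N\<close>.\<close>
  moreover have "(\<Sum>j\<le>4. c j * (pochhammer (m * N) j / pochhammer N j)) =
      3 * p * (2 + p * (N - 6)) / ((N + 1) * (N + 2) * (N + 3))"
    using N by (simp add: c_def eval_nat_numeral pochhammer_Suc p_def divide_simps add_pos_pos) algebra
  moreover have "\<dots> \<le> 3 * p / (N + 1)\<^sup>2"
  proof -
    \<comment> \<open>By p \<le> 1/4 the bracket \<open>2 + p * (N - 6)\<close> is at most
      \<open>N + 3\<close>, which cancels against the denominator while the factor p in front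
      survives.\<close>
    have "p * (N - 6) \<le> 1/4 * N"
    proof -
      have "p * N \<le> 1/4 * N" using p4 N by (intro mult_right_mono) auto
      with p show ?thesis by (simp add: algebra_simps)
    qed
    then have "(2 + p * (N - 6)) * (N + 1) \<le> (N + 3) * (N + 2)"
      using N p by (intro mult_mono) auto
    then have "3 * p * ((2 + p * (N - 6)) * (N + 1)) \<le> 3 * p * ((N + 3) * (N + 2))"
      using p by (intro mult_left_mono) auto
    with N show ?thesis by (simp add: divide_simps power2_eq_square add_pos_pos mult_ac)
  qed
  ultimately show ?thesis by (simp add: N_def p_def)
qed

end

subsection \<open>Moments of the operator U\<close>

context
  fixes \<rho> :: real and n :: nat
  assumes \<rho>: "\<rho> > 0" and n: "n \<ge> 1"
begin

lemma U_add:
  assumes "continuous_on {0..1} f" "continuous_on {0..1} g"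
  shows "U \<rho> n (\<lambda>t. f t + g t) x = U \<rho> n f x + U \<rho> n g x"
  by (simp add: U_eq_sum_functional[OF n] U_functional_add[OF \<rho> n _ assms] distrib_right flip: sum.distrib)

lemma U_cmult: "U \<rho> n (\<lambda>t. c * f t) x = c * U \<rho> n f x"
  by (simp add: U_eq_sum_functional[OF n] U_functional_cmult[OF \<rho> n] sum_distrib_left mult.assoc)

lemma U_mono:
  assumes "continuous_on {0..1} f" "continuous_on {0..1} g" "\<And>t. t \<in> {0..1} \<Longrightarrow> f t \<le> g t" "x \<in> {0..1}"
  shows "U \<rho> n f x \<le> U \<rho> n g x"
  unfolding U_eq_sum_functional[OF n]
  using assms by (intro sum_mono mult_right_mono U_functional_mono[OF \<rho> n] Bernstein_nonneg) auto

text \<open>Positivity of U applied to f and to its negative, the latter written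
  \<open>- 1 * f t\<close> to match \<open>U_cmult\<close>.\<close>

lemma U_abs_le:
  assumes f: "continuous_on {0..1} f" and g: "continuous_on {0..1} g"
    and le: "\<And>t. t \<in> {0..1} \<Longrightarrow> \<bar>f t\<bar> \<le> g t" and x: "x \<in> {0..1}"
  shows "\<bar>U \<rho> n f x\<bar> \<le> U \<rho> n g x"
proof -
  have "U \<rho> n f x \<le> U \<rho> n g x"
    by (rule U_mono[OF f g _ x]) (use le in \<open>fastforce simp: abs_le_iff\<close>)
  moreover have "U \<rho> n (\<lambda>t. - 1 * f t) x \<le> U \<rho> n g x"
    by (rule U_mono[OF _ g _ x]) (use le f in \<open>fastforce simp: abs_le_iff intro!: continuous_intros\<close>)+
  ultimately show ?thesis
    unfolding U_cmult by simp
qed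

lemma U_const: "U \<rho> n (\<lambda>_. c) x = c"
proof -
  have "U_functional \<rho> n k (\<lambda>_. 1) = 1" if "k \<le> n" for k
    using U_functional_power[OF \<rho> n that, of 0] by simp
  then have "U \<rho> n (\<lambda>_. 1) x = 1"
    by (simp add: U_eq_sum_functional[OF n])
  with U_cmult[of c "\<lambda>_. 1"] show ?thesis by simp
qed

text \<open>Each functional has mean k/n whatever \<rho> is, so U, like the Bernstein operator,
  reproduces affine functions.\<close>

lemma U_linear_part: "U \<rho> n (\<lambda>t. t - x) x = 0"
proof -
  have "U_functional \<rho> n k (\<lambda>t. t) = real k / real n" if "k \<le> n" for k
    using U_functional_power[OF \<rho> n that, of 1] \<rho> by simp
  then have "U \<rho> n (\<lambda>t. t) x = (\<Sum>k\<le>n. (real k / real n - x) * Bernstein n k x + x * Bernstein n k x)"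
    by (simp add: U_eq_sum_functional[OF n] left_diff_distrib)
  also have "\<dots> = x"
    by (simp add: sum.distrib Bernstein_scaled_mean[OF n] flip: sum_distrib_left)
  finally show ?thesis
    using U_add[of "\<lambda>t. t" "\<lambda>_. - x" x] by (simp add: U_const)
qed

text \<open>Law of total variance: the variance of the nodes plus the average of the Beta
  variances.\<close>

lemma U_square: "U \<rho> n (\<lambda>t. (t - x)\<^sup>2) x = x * (1 - x) * (\<rho> + 1) / (real n * \<rho> + 1)"
proof -
  define N where "N = real n * \<rho>"
  have N: "N > 0" using \<rho> n by (simp add: N_def)
  have "U \<rho> n (\<lambda>t. (t - x)\<^sup>2) x = (\<Sum>k\<le>n. (real k / real n - x)\<^sup>2 * Bernstein n k x
        + 1 / (N + 1) * (real k / real n * (1 - real k / real n) * Bernstein n k x))"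
    by (simp add: U_eq_sum_functional[OF n] U_functional_square[OF \<rho> n] distrib_right times_divide_eq_left
        del: times_divide_eq_right flip: N_def)
  also have "\<dots> = x * (1 - x) / real n + 1 / (N + 1) * (x * (1 - x) * (1 - 1 / real n))"
    by (simp only: sum.distrib Bernstein_scaled_variance[OF n] sum_Bernstein_phi[OF n] flip: sum_distrib_left)
  also have "\<dots> = x * (1 - x) * (1 / real n + 1 / (N + 1) * (1 - 1 / real n))"
    by (simp add: distrib_left)
  also have "1 / real n + 1 / (N + 1) * (1 - 1 / real n) = (\<rho> + 1) / (N + 1)"
  proof -
    have "real n \<noteq> 0" "N + 1 \<noteq> 0" using N n by auto
    then show ?thesis by (simp add: divide_simps) (simp add: N_def algebra_simps)
  qed
  finally show ?thesis by (simp add: N_def)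
qed

lemma U_quadratic:
  "U \<rho> n (\<lambda>t. a + b * (t - x) + c * (t - x)\<^sup>2) x = a + c * (x * (1 - x) * (\<rho> + 1) / (real n * \<rho> + 1))"
  by (subst U_add, (intro continuous_intros)+, subst U_add, (intro continuous_intros)+)
    (simp add: U_const U_cmult U_linear_part U_square)

text \<open>Expanding around x makes this a case of \<open>U_quadratic\<close>; the outcome is that
  \<open>t * (1 - t)\<close> is an eigenfunction of U.\<close>

lemma U_phi: "U \<rho> n (\<lambda>t. t * (1 - t)) x = (1 - (\<rho> + 1) / (real n * \<rho> + 1)) * (x * (1 - x))"
proof -
  have "(\<lambda>t. t * (1 - t)) = (\<lambda>t. x * (1 - x) + (1 - 2 * x) * (t - x) + (- 1) * (t - x)\<^sup>2)"
    by (rule ext) algebra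
  then show ?thesis
    by (simp only: U_quadratic) (simp add: algebra_simps add_divide_distrib diff_divide_distrib)
qed

text \<open>Splitting $t - x = (t - k/n) + (k/n - x)$ separates the central moments of the Beta and
  the binomial distribution.\<close>
lemma U_fourth_le:
  assumes x: "x \<in> {0..1}"
  shows "U \<rho> n (\<lambda>t. (t - x) ^ 4) x \<le> x * (1 - x) * (24 / (real n * \<rho> + 1)\<^sup>2 + 8 / (real n)\<^sup>2)"
proof -
  define N where "N = real n * \<rho>"
  have N: "N > 0" using \<rho> n by (simp add: N_def)
  \<comment> \<open>The constant 8 is \<open>2 ^ 3\<close>, from convexity of the fourth
    power.\<close>
  have quart: "(u + v) ^ 4 \<le> 8 * u ^ 4 + 8 * v ^ 4" for u v :: real
  proof -
    have "8 * u ^ 4 + 8 * v ^ 4 - (u + v) ^ 4 = (u - v)\<^sup>2 * (7 * u\<^sup>2 + 10 * u * v + 7 * v\<^sup>2)"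
      by algebra
    moreover have "7 * u\<^sup>2 + 10 * u * v + 7 * v\<^sup>2 = 5 * (u + v)\<^sup>2 + 2 * u\<^sup>2 + 2 * v\<^sup>2"
      by algebra
    ultimately have "8 * u ^ 4 + 8 * v ^ 4 - (u + v) ^ 4 \<ge> 0"
      by (simp add: add_nonneg_nonneg)
    then show ?thesis by simp
  qed
  have "U_functional \<rho> n k (\<lambda>t. (t - x) ^ 4)
      \<le> 24 / (N + 1)\<^sup>2 * (real k / real n * (1 - real k / real n)) + 8 * (real k / real n - x) ^ 4"
    if k: "k \<le> n" for k
  proof -
    define m where "m = real k / real n"
    \<comment> \<open>The factor \<open>t ^ 0\<close> presents the constant as a multiple of a
      power, so that \<open>U_functional_power\<close> evaluates it.\<close>
    have "U_functional \<rho> n k (\<lambda>t. (t - x) ^ 4) \<le> U_functional \<rho> n k (\<lambda>t. 8 * (t - m) ^ 4 + 8 * (m - x) ^ 4 * t ^ 0)"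
      by (intro U_functional_mono[OF \<rho> n k] continuous_intros) (use quart[of "_ - m" "m - x"] in simp)
    also have "\<dots> = 8 * U_functional \<rho> n k (\<lambda>t. (t - m) ^ 4) + 8 * (m - x) ^ 4"
      by (subst U_functional_add[OF \<rho> n k], (intro continuous_intros)+)
        (simp only: U_functional_cmult[OF \<rho> n k] U_functional_power[OF \<rho> n k], simp)
    also have "\<dots> \<le> 8 * (3 * (m * (1 - m)) / (N + 1)\<^sup>2) + 8 * (m - x) ^ 4"
      using U_functional_central4_le[OF \<rho> n k] by (simp add: m_def N_def)
    also have "\<dots> = 24 / (N + 1)\<^sup>2 * (m * (1 - m)) + 8 * (m - x) ^ 4"
      by simp
    finally show ?thesis unfolding m_def .
  qed
  then have "U \<rho> n (\<lambda>t. (t - x) ^ 4) x \<le> (\<Sum>k\<le>n. (24 / (N + 1)\<^sup>2 * (real k / real n * (1 - real k / real n))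
        + 8 * (real k / real n - x) ^ 4) * Bernstein n k x)"
    unfolding U_eq_sum_functional[OF n] using x by (intro sum_mono mult_right_mono Bernstein_nonneg) auto
  also have "\<dots> = 24 / (N + 1)\<^sup>2 * (\<Sum>k\<le>n. real k / real n * (1 - real k / real n) * Bernstein n k x)
        + 8 * (\<Sum>k\<le>n. (real k / real n - x) ^ 4 * Bernstein n k x)"
    by (simp only: distrib_right sum.distrib mult.assoc sum_distrib_left)
  also have "\<dots> \<le> 24 / (N + 1)\<^sup>2 * (x * (1 - x)) + 8 * (x * (1 - x) / (real n)\<^sup>2)"
  proof (intro add_mono mult_left_mono)
    show "(\<Sum>k\<le>n. real k / real n * (1 - real k / real n) * Bernstein n k x) \<le> x * (1 - x)"
      unfolding sum_Bernstein_phi[OF n] using x n by (intro mult_left_le) auto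
    have "(\<Sum>k\<le>n. (real k / real n - x) ^ 4 * Bernstein n k x) \<le> x * (1 - x) * (real n)\<^sup>2 / real n ^ 4"
      unfolding Bernstein_scaled_power[OF n] by (intro divide_right_mono Bernstein_central_moment4_le x) simp
    also have "\<dots> = x * (1 - x) / (real n)\<^sup>2"
      using n by (simp add: field_simps eval_nat_numeral)
    finally show "(\<Sum>k\<le>n. (real k / real n - x) ^ 4 * Bernstein n k x) \<le> x * (1 - x) / (real n)\<^sup>2" .
  qed auto
  finally show ?thesis by (simp add: N_def algebra_simps)
qed

text \<open>The slope b disappears because U annihilates \<open>t - x\<close> at x. The second and
  fourth moments each contribute the factor \<open>x * (1 - x)\<close> that the norm of
  \<open>C0\<close> requires.\<close>

lemma U_Taylor_remainder:
  assumes y: "continuous_on {0..1} y" and x: "x \<in> {0..1}" and \<beta>: "\<beta> \<ge> 0"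
    and le: "\<And>t. t \<in> {0..1} \<Longrightarrow> \<bar>y t - (y x + b * (t - x) + c * (t - x)\<^sup>2)\<bar> \<le> \<alpha> * (t - x)\<^sup>2 + \<beta> * (t - x) ^ 4"
  shows "\<bar>U \<rho> n y x - (y x + c * (x * (1 - x) * (\<rho> + 1) / (real n * \<rho> + 1)))\<bar>
    \<le> x * (1 - x) * (\<alpha> * (\<rho> + 1) / (real n * \<rho> + 1) + \<beta> * (24 / (real n * \<rho> + 1)\<^sup>2 + 8 / (real n)\<^sup>2))"
proof -
  define g where "g t = y x + b * (t - x) + c * (t - x)\<^sup>2" for t
  have g: "continuous_on {0..1} g"
    unfolding g_def by (intro continuous_intros)
  have "U \<rho> n y x = U \<rho> n (\<lambda>t. (y t - g t) + g t) x" by simp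
  also have "\<dots> = U \<rho> n (\<lambda>t. y t - g t) x + U \<rho> n g x"
    by (intro U_add continuous_on_diff y g)
  also have "U \<rho> n g x = y x + c * (x * (1 - x) * (\<rho> + 1) / (real n * \<rho> + 1))"
    unfolding g_def by (rule U_quadratic)
  finally have "\<bar>U \<rho> n y x - (y x + c * (x * (1 - x) * (\<rho> + 1) / (real n * \<rho> + 1)))\<bar> = \<bar>U \<rho> n (\<lambda>t. y t - g t) x\<bar>"
    by simp
  also have "\<dots> \<le> U \<rho> n (\<lambda>t. \<alpha> * (t - x)\<^sup>2 + \<beta> * (t - x) ^ 4) x"
    by (rule U_abs_le[OF continuous_on_diff[OF y g] _ _ x]) (use le in \<open>auto simp: g_def intro!: continuous_intros\<close>)
  also have "\<dots> = \<alpha> * (x * (1 - x) * (\<rho> + 1) / (real n * \<rho> + 1)) + \<beta> * U \<rho> n (\<lambda>t. (t - x) ^ 4) x"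
    by (subst U_add, (intro continuous_intros)+) (simp only: U_cmult U_square)
  also have "\<dots> \<le> \<alpha> * (x * (1 - x) * (\<rho> + 1) / (real n * \<rho> + 1))
      + \<beta> * (x * (1 - x) * (24 / (real n * \<rho> + 1)\<^sup>2 + 8 / (real n)\<^sup>2))"
    by (intro add_left_mono mult_left_mono U_fourth_le x \<beta>)
  also have "\<dots> = x * (1 - x) * (\<alpha> * (\<rho> + 1) / (real n * \<rho> + 1) + \<beta> * (24 / (real n * \<rho> + 1)\<^sup>2 + 8 / (real n)\<^sup>2))"
    by (simp add: algebra_simps)
  finally show ?thesis .
qed

end

subsection \<open>The operators on the space C0\<close>

text \<open>Division by \<open>x * (1 - x)\<close> is possible only in the open interval; continuity
  of \<open>factor f\<close> carries the bound to the endpoints.\<close>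

lemma norm_C0_leI:
  assumes "\<And>x. x \<in> {0<..<1} \<Longrightarrow> \<bar>apply_C0 f x\<bar> \<le> b * (x * (1 - x))"
  shows "norm f \<le> b"
proof (rule norm_C0_le)
  fix x :: real assume x: "x \<in> {0..1}"
  have cl: "closure {0<..<1::real} = {0..1}"
    by simp
  show "\<bar>factor f x\<bar> \<le> b"
  proof (rule continuous_le_on_closure[of "{0<..<1}" "\<lambda>x. \<bar>factor f x\<bar>" x b])
    show "continuous_on (closure {0<..<1}) (\<lambda>x. \<bar>factor f x\<bar>)"
      unfolding cl by (intro continuous_intros factor)
    show "x \<in> closure {0<..<1}"
      using x by (simp only: cl)
    fix t :: real assume t: "t \<in> {0<..<1}"
    then have "\<bar>factor f t\<bar> * (t * (1 - t)) = \<bar>apply_C0 f t\<bar>"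
      by (simp add: factor(2) abs_mult)
    then have "\<bar>factor f t\<bar> * (t * (1 - t)) \<le> b * (t * (1 - t))"
      using assms[OF t] by simp
    then show "\<bar>factor f t\<bar> \<le> b"
      using t by (simp add: mult_le_cancel_right)
  qed
qed

lemma abs_apply_C0_le_norm:
  assumes "x \<in> {0..1}"
  shows "\<bar>apply_C0 f x\<bar> \<le> norm f * (x * (1 - x))"
  using mult_right_mono[OF factor_le_norm_C0[OF assms, of f], of "x * (1 - x)"] assms
  by (simp add: factor(2) abs_mult mult.commute)

text \<open>Positivity of U applied to the majorant \<open>norm f * (t * (1 - t))\<close>, an
  eigenfunction by \<open>U_phi\<close>.\<close>

lemma norm_U_C0_le:
  assumes "\<rho> > 0" "n \<ge> 1"
  shows "norm (U_C0 \<rho> n) \<le> 1 - (\<rho> + 1) / (real n * \<rho> + 1)"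
proof (rule norm_blinfun_bound)
  have "\<rho> * 1 \<le> \<rho> * real n"
    using assms by (intro mult_left_mono) auto
  then have "\<rho> + 1 \<le> real n * \<rho> + 1" by (simp add: mult.commute)
  then show nonneg: "0 \<le> 1 - (\<rho> + 1) / (real n * \<rho> + 1)"
    using assms by (simp add: divide_le_eq add_nonneg_pos)
  fix f
  show "norm (blinfun_apply (U_C0 \<rho> n) f) \<le> (1 - (\<rho> + 1) / (real n * \<rho> + 1)) * norm f"
  proof (rule norm_C0_leI)
    fix x :: real assume x: "x \<in> {0<..<1}"
    then have x': "x \<in> {0..1}" by simp
    have "\<bar>U \<rho> n (apply_C0 f) x\<bar> \<le> U \<rho> n (\<lambda>t. norm f * (t * (1 - t))) x"
      by (intro U_abs_le assms continuous_apply_C0 abs_apply_C0_le_norm x' continuous_intros)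
    also have "\<dots> = norm f * ((1 - (\<rho> + 1) / (real n * \<rho> + 1)) * (x * (1 - x)))"
      by (simp only: U_cmult[OF assms] U_phi[OF assms])
    finally show "\<bar>apply_C0 (blinfun_apply (U_C0 \<rho> n) f) x\<bar>
        \<le> (1 - (\<rho> + 1) / (real n * \<rho> + 1)) * norm f * (x * (1 - x))"
      using x' by (simp add: U_C0_apply[OF assms(1)] zero_ext_def mult_ac)
  qed
qed

section \<open>The Neumann series defining \<open>A_n\<close>\<close>

lemma norm_blinfun_compose_power_le:
  fixes T :: "'a::real_normed_vector \<Rightarrow>\<^sub>L 'a"
  shows "norm (((o\<^sub>L) T ^^ k) id_blinfun) \<le> norm T ^ k"
proof (induction k)
  case 0
  show ?case by (simp add: norm_blinfun_id_le)
next
  case (Suc k)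
  have "norm (T o\<^sub>L ((o\<^sub>L) T ^^ k) id_blinfun) \<le> norm T * norm (((o\<^sub>L) T ^^ k) id_blinfun)"
    by (rule norm_blinfun_compose)
  also have "\<dots> \<le> norm T * norm T ^ k"
    by (intro mult_left_mono Suc.IH) simp
  finally show ?case by simp
qed

lemma blinfun_apply_compose_power:
  fixes T :: "'a::real_normed_vector \<Rightarrow>\<^sub>L 'a"
  shows "blinfun_apply (((o\<^sub>L) T ^^ k) id_blinfun) v = (blinfun_apply T ^^ k) v"
  by (induction k) auto

context
  fixes \<rho> :: real and n :: nat
  assumes \<rho>: "\<rho> > 0" and n: "n \<ge> 1"
begin

lemma U_C0_series:
  defines "B \<equiv> \<lambda>k. ((o\<^sub>L) (U_C0 \<rho> n) ^^ k) id_blinfun"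
  shows "summable (\<lambda>k. norm (B k))" "(\<Sum>k. norm (B k)) \<le> (real n * \<rho> + 1) / (\<rho> + 1)"
proof -
  define q where "q = 1 - (\<rho> + 1) / (real n * \<rho> + 1)"
  have N: "real n * \<rho> + 1 > 0" using \<rho> by (simp add: add_nonneg_pos)
  have q0: "norm (U_C0 \<rho> n) \<le> q"
    unfolding q_def by (rule norm_U_C0_le[OF \<rho> n])
  have q: "0 \<le> q" "q < 1"
    using order.trans[OF norm_ge_zero q0] N \<rho> by (auto simp: q_def)
  have le: "norm (B k) \<le> q ^ k" for k
    unfolding B_def using norm_blinfun_compose_power_le power_mono[OF q0 norm_ge_zero] order.trans by blast
  have sq: "summable (\<lambda>k. q ^ k)"
    using q by (simp add: summable_geometric)
  show s: "summable (\<lambda>k. norm (B k))"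
    by (rule summable_comparison_test'[OF sq]) (use le in simp)
  have "(\<Sum>k. norm (B k)) \<le> (\<Sum>k. q ^ k)"
    by (intro suminf_le le s sq)
  also have "\<dots> = 1 / (1 - q)"
    using q by (simp add: suminf_geometric)
  also have "\<dots> = (real n * \<rho> + 1) / (\<rho> + 1)"
    by (simp add: q_def)
  finally show "(\<Sum>k. norm (B k)) \<le> (real n * \<rho> + 1) / (\<rho> + 1)" .
qed

text \<open>The prefactor of \<open>A_n\<close> cancels the growth in n of the geometric series,
  leaving a bound uniform in n.\<close>

lemma norm_A_n_le: "norm (A_n \<rho> n) \<le> \<rho> / (\<rho> + 1)"
proof -
  have N: "real n * \<rho> + 1 > 0" using \<rho> by (simp add: add_nonneg_pos)
  have "norm (\<Sum>k. ((o\<^sub>L) (U_C0 \<rho> n) ^^ k) id_blinfun) \<le> (real n * \<rho> + 1) / (\<rho> + 1)"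
    using summable_norm[OF U_C0_series(1)] U_C0_series(2) by (rule order.trans)
  then have "norm (A_n \<rho> n) \<le> \<rho> / (real n * \<rho> + 1) * ((real n * \<rho> + 1) / (\<rho> + 1))"
    unfolding A_n_def norm_scaleR using N \<rho> by (intro mult_mono) auto
  with N show ?thesis by simp
qed

text \<open>The Neumann series applied to \<open>v - U v\<close> telescopes to v, because the powers
  of U tend to 0.\<close>

lemma A_n_minus_U_C0:
  "blinfun_apply (A_n \<rho> n) (v - blinfun_apply (U_C0 \<rho> n) v) = (\<rho> / (real n * \<rho> + 1)) *\<^sub>R v"
proof -
  define T where "T = U_C0 \<rho> n"
  define B where "B k = ((o\<^sub>L) T ^^ k) id_blinfun" for k
  have s: "summable (\<lambda>k. norm (B k))"
    unfolding B_def T_def by (rule U_C0_series)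
  have "(\<lambda>k. norm (B k)) \<longlonglongrightarrow> 0"
    by (rule summable_LIMSEQ_zero[OF s])
  then have "B \<longlonglongrightarrow> 0"
    by (simp add: tendsto_norm_zero_iff)
  then have "(\<lambda>k. blinfun_apply (B k) v) \<longlonglongrightarrow> blinfun_apply 0 v"
    by (intro tendsto_intros)
  then have "(\<lambda>k. blinfun_apply (B k) v - blinfun_apply (B (Suc k)) v) sums (blinfun_apply (B 0) v - 0)"
    by (intro telescope_sums') simp
  moreover have "blinfun_apply (B k) (v - blinfun_apply T v) = blinfun_apply (B k) v - blinfun_apply (B (Suc k)) v" for k
    unfolding B_def blinfun.diff_right blinfun_apply_compose_power by (simp add: funpow_swap1)
  ultimately have "(\<lambda>k. blinfun_apply (B k) (v - blinfun_apply T v)) sums v"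
    by (simp add: B_def)
  moreover have "(\<lambda>k. blinfun_apply (B k) (v - blinfun_apply T v)) sums blinfun_apply (\<Sum>k. B k) (v - blinfun_apply T v)"
    by (intro bounded_linear.sums[OF blinfun.bounded_linear_left] summable_sums summable_norm_cancel[OF s])
  ultimately have "blinfun_apply (\<Sum>k. B k) (v - blinfun_apply T v) = v"
    by (rule sums_unique2[symmetric])
  then show ?thesis
    by (simp add: A_n_def B_def T_def scaleR_blinfun.rep_eq)
qed

end

subsection \<open>The differential operator\<close>

lemma deriv01_works:
  "y differentiable (at x within {0..1}) \<Longrightarrow> (y has_real_derivative deriv01 y x) (at x within {0..1})"
  by (simp add: deriv01_def has_real_derivative_iff_has_vector_derivative flip: vector_derivative_works)

text \<open>Every point of \<open>{0..1}\<close> is a limit point of the interval, so one-sided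
  derivatives are unique as well.\<close>

lemma deriv01_eqI:
  assumes "(y has_real_derivative d) (at x within {0..1})" "x \<in> {0..1}"
  shows "deriv01 y x = d"
  using vector_derivative_within_cbox[of 0 1 x y d] assms
  by (simp add: deriv01_def has_real_derivative_iff_has_vector_derivative)

lemma C2_01_derivs:
  assumes "y \<in> C2_01" "x \<in> {0..1}"
  shows "(y has_real_derivative deriv01 y x) (at x within {0..1})"
    "(deriv01 y has_real_derivative deriv01 (deriv01 y) x) (at x within {0..1})"
  using assms by (auto simp: C2_01_def intro!: deriv01_works)

lemma C2_01_continuous:
  assumes "y \<in> C2_01"
  shows "continuous_on {0..1} y"
  using C2_01_derivs(1)[OF assms] by (rule DERIV_continuous_on)

section \<open>Taylor expansion with a uniform remainder\<close>

lemma C2_01_Taylor: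
  assumes y: "y \<in> C2_01" and x: "x \<in> {0<..<1}" and t: "t \<in> {0<..<1}"
  shows "\<exists>\<xi>\<in>{0..1}. \<bar>\<xi> - x\<bar> \<le> \<bar>t - x\<bar>
    \<and> y t = y x + deriv01 y x * (t - x) + deriv01 (deriv01 y) \<xi> / 2 * (t - x)\<^sup>2"
proof (cases "t = x")
  case True
  with x show ?thesis by auto
next
  case False
  define D where "D m = (if m = 0 then y else if m = 1 then deriv01 y else deriv01 (deriv01 y))" for m :: nat
  have "\<exists>\<xi>. (if t < x then t < \<xi> \<and> \<xi> < x else x < \<xi> \<and> \<xi> < t) \<and>
      y t = (\<Sum>m<2. D m x / fact m * (t - x) ^ m) + D 2 \<xi> / fact 2 * (t - x)\<^sup>2"
  proof (rule Taylor[where a = "min t x" and b = "max t x"])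
    show "\<forall>m s. m < 2 \<and> min t x \<le> s \<and> s \<le> max t x \<longrightarrow> (D m has_real_derivative D (Suc m) s) (at s)"
    proof (intro allI impI)
      fix m s assume ms: "m < (2 :: nat) \<and> min t x \<le> s \<and> s \<le> max t x"
      then have s: "0 < s" "s < 1" using x t by auto
      \<comment> \<open>Both x and t are interior, so the derivatives within the interval are the
        two-sided ones that \<open>Taylor\<close> expects.\<close>
      then have "at s within {0..1} = at s"
        by (rule at_within_Icc_at)
      with C2_01_derivs[OF y, of s] s ms show "(D m has_real_derivative D (Suc m) s) (at s)"
        by (auto simp: D_def less_2_cases_iff)
    qed
  qed (use False in \<open>auto simp: D_def\<close>)
  then obtain \<xi> where "if t < x then t < \<xi> \<and> \<xi> < x else x < \<xi> \<and> \<xi> < t"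
    "y t = y x + deriv01 y x * (t - x) + deriv01 (deriv01 y) \<xi> / 2 * (t - x)\<^sup>2"
    by (auto simp: D_def numeral_2_eq_2)
  then show ?thesis using x t by (intro bexI[of _ \<xi>]) (auto split: if_splits)
qed

text \<open>Uniform continuity handles points closer than d. For the others the oscillation is at
  most \<open>2 * M\<close>, M being a bound of g, and \<open>(s - x)\<^sup>2 / d\<^sup>2\<close> is
  at least 1. The quadratic form lets moments of U absorb the error.\<close>

lemma continuous_modulus_quadratic:
  fixes g :: "real \<Rightarrow> real"
  assumes g: "continuous_on {a..b} g" and e: "e > 0"
  obtains K where "K \<ge> 0" "\<And>s x. s \<in> {a..b} \<Longrightarrow> x \<in> {a..b} \<Longrightarrow> \<bar>g s - g x\<bar> \<le> e + K * (s - x)\<^sup>2"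
proof -
  obtain M where "\<forall>z\<in>g ` {a..b}. norm z \<le> M"
    using compact_imp_bounded[OF compact_continuous_image[OF g compact_Icc]] unfolding bounded_iff by blast
  then have M: "\<bar>g x\<bar> \<le> M" if "x \<in> {a..b}" for x
    using that by auto
  have "uniformly_continuous_on {a..b} g"
    using g by (rule compact_uniformly_continuous) simp
  then obtain d where d: "d > 0" "\<And>s x. s \<in> {a..b} \<Longrightarrow> x \<in> {a..b} \<Longrightarrow> \<bar>s - x\<bar> < d \<Longrightarrow> \<bar>g s - g x\<bar> < e"
    using e unfolding uniformly_continuous_on_def dist_real_def by metis
  show thesis
  proof (rule that[of "2 * \<bar>M\<bar> / d\<^sup>2"])
    fix s x assume sx: "s \<in> {a..b}" "x \<in> {a..b}"
    show "\<bar>g s - g x\<bar> \<le> e + 2 * \<bar>M\<bar> / d\<^sup>2 * (s - x)\<^sup>2"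
    proof (cases "\<bar>s - x\<bar> < d")
      case True
      then have "\<bar>g s - g x\<bar> \<le> e" using d(2)[OF sx] by simp
      then show ?thesis by (simp add: add_increasing2)
    next
      case False
      then have "d\<^sup>2 \<le> (s - x)\<^sup>2"
        using d(1) by (simp add: abs_le_square_iff[symmetric])
      then have "2 * \<bar>M\<bar> / d\<^sup>2 * d\<^sup>2 \<le> 2 * \<bar>M\<bar> / d\<^sup>2 * (s - x)\<^sup>2"
        by (intro mult_left_mono) auto
      then have "2 * \<bar>M\<bar> \<le> 2 * \<bar>M\<bar> / d\<^sup>2 * (s - x)\<^sup>2" using d(1) by simp
      then show ?thesis using M[OF sx(1)] M[OF sx(2)] e by linarith
    qed
  qed simp
qed

text \<open>The modulus bound for the second derivative, taken at the intermediate point and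
  multiplied by \<open>(t - x)\<^sup>2\<close>. K depends on neither x nor t, which makes the later
  estimate uniform.\<close>

lemma C2_01_Taylor_remainder:
  assumes y: "y \<in> C2_01" and e: "e > 0"
  obtains K where "K \<ge> 0"
    "\<And>x t. x \<in> {0<..<1} \<Longrightarrow> t \<in> {0..1} \<Longrightarrow>
      \<bar>y t - (y x + deriv01 y x * (t - x) + deriv01 (deriv01 y) x / 2 * (t - x)\<^sup>2)\<bar> \<le> e * (t - x)\<^sup>2 + K * (t - x) ^ 4"
proof -
  define g where "g = deriv01 (deriv01 y)"
  have "continuous_on {0..1} g" using y by (simp add: C2_01_def g_def)
  from continuous_modulus_quadratic[OF this e] obtain K where K: "K \<ge> 0"
    "\<And>s x. s \<in> {0..1} \<Longrightarrow> x \<in> {0..1} \<Longrightarrow> \<bar>g s - g x\<bar> \<le> e + K * (s - x)\<^sup>2"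
    by blast
  show thesis
  proof (rule that[OF K(1)])
    fix x t :: real assume x: "x \<in> {0<..<1}" and t: "t \<in> {0..1}"
    define R where "R t = y t - (y x + deriv01 y x * (t - x) + g x / 2 * (t - x)\<^sup>2)" for t
    have interior: "\<bar>R t\<bar> - (e * (t - x)\<^sup>2 + K * (t - x) ^ 4) \<le> 0" if t: "t \<in> {0<..<1}" for t
    proof -
      obtain \<xi> where \<xi>: "\<xi> \<in> {0..1}" "\<bar>\<xi> - x\<bar> \<le> \<bar>t - x\<bar>"
        "y t = y x + deriv01 y x * (t - x) + g \<xi> / 2 * (t - x)\<^sup>2"
        using C2_01_Taylor[OF y x t] by (auto simp: g_def)
      have "(\<xi> - x)\<^sup>2 \<le> (t - x)\<^sup>2"
        using \<xi>(2) by (simp add: abs_le_square_iff)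
      then have "\<bar>g \<xi> - g x\<bar> \<le> e + K * (t - x)\<^sup>2"
        using K(2)[OF \<xi>(1), of x] x mult_left_mono[OF _ K(1)] by fastforce
      then have "\<bar>g \<xi> - g x\<bar> / 2 * (t - x)\<^sup>2 \<le> (e + K * (t - x)\<^sup>2) * (t - x)\<^sup>2"
        by (intro mult_right_mono) auto
      moreover have "R t = (g \<xi> - g x) / 2 * (t - x)\<^sup>2"
        by (simp add: R_def \<xi>(3) left_diff_distrib diff_divide_distrib)
      then have "\<bar>R t\<bar> = \<bar>g \<xi> - g x\<bar> / 2 * (t - x)\<^sup>2"
        by (simp only: abs_mult abs_divide abs_numeral abs_power2)
      moreover have "(e + K * (t - x)\<^sup>2) * (t - x)\<^sup>2 = e * (t - x)\<^sup>2 + K * (t - x) ^ 4" by algebra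
      ultimately show ?thesis by linarith
    qed
    have cl: "closure {0<..<1::real} = {0..1}"
      by simp
    \<comment> \<open>Endpoints t are reached by continuity.\<close>
    have "\<bar>R t\<bar> - (e * (t - x)\<^sup>2 + K * (t - x) ^ 4) \<le> 0"
    proof (rule continuous_le_on_closure[of "{0<..<1}" "\<lambda>t. \<bar>R t\<bar> - (e * (t - x)\<^sup>2 + K * (t - x) ^ 4)"])
      show "continuous_on (closure {0<..<1}) (\<lambda>t. \<bar>R t\<bar> - (e * (t - x)\<^sup>2 + K * (t - x) ^ 4))"
        unfolding cl R_def by (intro continuous_intros C2_01_continuous[OF y])
      show "t \<in> closure {0<..<1}"
        using t by (simp only: cl)
    qed (use interior in blast)
    then show "\<bar>y t - (y x + deriv01 y x * (t - x) + deriv01 (deriv01 y) x / 2 * (t - x)\<^sup>2)\<bar>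
        \<le> e * (t - x)\<^sup>2 + K * (t - x) ^ 4"
      by (simp add: R_def g_def)
  qed
qed

section \<open>Embedding of the domain into \<open>C0\<close> and surjectivity of the differential
  operator\<close>

lemma A_dom_in_C0:
  assumes "y \<in> A_dom"
  obtains Y where "apply_C0 Y = y"
proof -
  have y: "y \<in> C2_01" "y 0 = 0" "y 1 = 0" and out: "\<And>x. x \<notin> {0..1} \<Longrightarrow> y x = 0"
    using assms by (auto simp: A_dom_def)
  \<comment> \<open>As y vanishes at 0 and 1, the quotient by \<open>x * (1 - x)\<close> has limits
    there given by difference quotients of y; the minus sign at 1 comes from
    \<open>1 - x\<close>.\<close>
  define h where "h x = (if x = 0 then deriv01 y 0 else if x = 1 then - deriv01 y 1 else y x / (x * (1 - x)))" for x
  have "continuous (at x within {0..1}) h" if x: "x \<in> {0..1}" for x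
  proof -
    consider "x = 0" | "x = 1" | "0 < x" "x < 1" using x by fastforce
    then show ?thesis
    proof cases
      case 1
      have "((\<lambda>t. (y t - y 0) / (t - 0) * (1 / (1 - t))) \<longlongrightarrow> deriv01 y 0 * (1 / (1 - 0))) (at 0 within {0..1})"
        using C2_01_derivs(1)[OF y(1), of 0] by (intro tendsto_intros) (auto simp: has_field_derivative_iff)
      then have "(h \<longlongrightarrow> deriv01 y 0 * (1 / (1 - 0))) (at 0 within {0..1})"
        by (rule Lim_transform_within[where d = 1]) (auto simp: h_def y dist_real_def)
      with 1 show ?thesis by (simp add: continuous_within h_def)
    next
      case 2
      have "((\<lambda>t. (y t - y 1) / (t - 1) * (- 1 / t)) \<longlongrightarrow> deriv01 y 1 * (- 1 / 1)) (at 1 within {0..1})"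
        using C2_01_derivs(1)[OF y(1), of 1] by (intro tendsto_intros) (auto simp: has_field_derivative_iff)
      then have "(h \<longlongrightarrow> deriv01 y 1 * (- 1 / 1)) (at 1 within {0..1})"
        by (rule Lim_transform_within[where d = 1]) (auto simp: h_def y dist_real_def divide_simps algebra_simps)
      with 2 show ?thesis by (simp add: continuous_within h_def)
    next
      case 3
      have "continuous (at x within {0..1}) y"
        using C2_01_continuous[OF y(1)] x by (simp add: continuous_on_eq_continuous_within)
      then have "continuous (at x within {0..1}) (\<lambda>t. y t / (t * (1 - t)))"
        using 3 by (intro continuous_intros) auto
      then show ?thesis
        by (rule continuous_transform_within[where \<delta> = "min x (1 - x)"])
          (use 3 in \<open>auto simp: h_def dist_real_def\<close>)
    qed
  qed
  then have "continuous_on {0..1} h"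
    by (simp add: continuous_on_eq_continuous_within)
  moreover have "y x = x * (1 - x) * h x" if "x \<in> {0..1}" for x
    using y by (simp add: h_def)
  ultimately have "apply_C0 (Abs_C0 y) = y"
    using out by (intro Abs_C0_inverse) auto
  then show thesis by (rule that)
qed

text \<open>Integrate twice from 0, then subtract the chord \<open>x * H2 1\<close> to obtain
  \<open>y 1 = 0\<close> without changing the second derivative. The constant in k cancels the one
  in \<open>A_op\<close>.\<close>

lemma A_op_surj:
  assumes "\<rho> > 0"
  obtains y where "y \<in> A_dom" "A_op \<rho> y = f"
proof -
  define k where "k x = 2 * \<rho> / (\<rho> + 1) * factor f x" for x
  define H1 where "H1 x = integral {0..x} k" for x
  define H2 where "H2 x = integral {0..x} H1" for x
  define y where "y = zero_ext (\<lambda>x. H2 x - x * H2 1)"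
  have k: "continuous_on {0..1} k"
    unfolding k_def by (intro continuous_intros factor)
  have H1: "(H1 has_real_derivative k x) (at x within {0..1})" if "x \<in> {0..1}" for x
    unfolding H1_def by (rule integral_has_real_derivative[OF k that])
  then have "continuous_on {0..1} H1" by (rule DERIV_continuous_on)
  then have H2: "(H2 has_real_derivative H1 x) (at x within {0..1})" if "x \<in> {0..1}" for x
    unfolding H2_def using that by (rule integral_has_real_derivative)
  have y1: "(y has_real_derivative (H1 x - H2 1)) (at x within {0..1})" if x: "x \<in> {0..1}" for x
  proof (rule has_field_derivative_transform_within[where d = 1])
    show "((\<lambda>x. H2 x - x * H2 1) has_real_derivative (H1 x - H2 1)) (at x within {0..1})"
      using H2[OF x] by (auto intro!: derivative_eq_intros)
  qed (use x in \<open>auto simp: y_def zero_ext_def\<close>)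
  then have d1: "deriv01 y x = H1 x - H2 1" if "x \<in> {0..1}" for x
    using that by (intro deriv01_eqI)
  have y2: "(deriv01 y has_real_derivative k x) (at x within {0..1})" if x: "x \<in> {0..1}" for x
  proof (rule has_field_derivative_transform_within[where d = 1])
    show "((\<lambda>x. H1 x - H2 1) has_real_derivative k x) (at x within {0..1})"
      using H1[OF x] by (auto intro!: derivative_eq_intros)
  qed (use x d1 in auto)
  then have d2: "deriv01 (deriv01 y) x = k x" if "x \<in> {0..1}" for x
    using that by (intro deriv01_eqI)
  have "continuous_on {0..1} (deriv01 (deriv01 y))"
    using k by (rule continuous_on_eq) (simp add: d2)
  with y1 y2 have "y \<in> C2_01"
    unfolding C2_01_def real_differentiable_def by blast
  then have y: "y \<in> A_dom"
    by (auto simp: A_dom_def y_def zero_ext_def H2_def)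
  have "A_op \<rho> y = f"
    using assms by (intro C0_eqI) (simp add: A_op_apply[OF y] zero_ext_def d2 k_def factor(2))
  with y show thesis by (rule that)
qed

subsection \<open>Convergence\<close>

lemma U_C0_Voronovskaja:
  assumes \<rho>: "\<rho> > 0" and y: "y \<in> A_dom" and Y: "apply_C0 Y = y"
  shows "(\<lambda>n. ((real n * \<rho> + 1) / \<rho>) *\<^sub>R (blinfun_apply (U_C0 \<rho> n) Y - Y) - A_op \<rho> y) \<longlonglongrightarrow> 0"
    (is "?r \<longlonglongrightarrow> 0")
proof (rule tendstoI)
  fix e :: real assume e: "e > 0"
  have y2: "y \<in> C2_01" using y by (simp add: A_dom_def)
  \<comment> \<open>Chosen so that the scaled second-moment error is exactly
    \<open>e / 4\<close>.\<close>
  define \<alpha> where "\<alpha> = e / 4 * \<rho> / (\<rho> + 1)"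
  have "\<alpha> > 0" using e \<rho> by (simp add: \<alpha>_def)
  from C2_01_Taylor_remainder[OF y2 this] obtain K where K: "K \<ge> 0"
    "\<And>x t. x \<in> {0<..<1} \<Longrightarrow> t \<in> {0..1} \<Longrightarrow>
      \<bar>y t - (y x + deriv01 y x * (t - x) + deriv01 (deriv01 y) x / 2 * (t - x)\<^sup>2)\<bar> \<le> \<alpha> * (t - x)\<^sup>2 + K * (t - x) ^ 4"
    by blast
  \<comment> \<open>The scaled fourth-moment error, of order 1/n for the fixed K.\<close>
  define \<delta> where "\<delta> n = (real n * \<rho> + 1) / \<rho> * (K * (24 / (real n * \<rho> + 1)\<^sup>2 + 8 / (real n)\<^sup>2))" for n
  have "\<delta> \<longlonglongrightarrow> 0"
    unfolding \<delta>_def using \<rho> by real_asymp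
  then have "\<forall>\<^sub>F n in sequentially. \<delta> n < e / 4"
    by (rule order_tendstoD) (use e in simp)
  then show "\<forall>\<^sub>F n in sequentially. dist (?r n) 0 < e"
    using eventually_ge_at_top[of 1]
  proof eventually_elim
    case (elim n)
    define N1 where "N1 = real n * \<rho> + 1"
    have N1: "N1 > 0" using \<rho> by (simp add: N1_def add_nonneg_pos)
    have "norm (?r n) \<le> e / 4 + \<delta> n"
    proof (rule norm_C0_leI)
      fix x :: real assume x: "x \<in> {0<..<1}"
      then have x': "x \<in> {0..1}" by simp
      define g where "g = deriv01 (deriv01 y) x"
      have "apply_C0 (?r n) x = N1 / \<rho> * (U \<rho> n y x - y x) - (\<rho> + 1) / (2 * \<rho>) * x * (1 - x) * g"
        using x' by (simp add: minus_C0.rep_eq scaleR_C0.rep_eq U_C0_apply[OF \<rho>] Y A_op_apply[OF y] zero_ext_def N1_def g_def)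
      \<comment> \<open>The second-moment term of the expansion, once scaled, is exactly
        \<open>A_op \<rho> y\<close>.\<close>
      also have "(\<rho> + 1) / (2 * \<rho>) * x * (1 - x) * g = N1 / \<rho> * (g / 2 * (x * (1 - x) * (\<rho> + 1) / N1))"
        using N1 \<rho> by (simp add: mult_ac)
      also have "N1 / \<rho> * (U \<rho> n y x - y x) - \<dots> = N1 / \<rho> * (U \<rho> n y x - (y x + g / 2 * (x * (1 - x) * (\<rho> + 1) / N1)))"
        by (simp only: right_diff_distrib distrib_left diff_diff_eq)
      finally have "\<bar>apply_C0 (?r n) x\<bar> = N1 / \<rho> * \<bar>U \<rho> n y x - (y x + g / 2 * (x * (1 - x) * (\<rho> + 1) / N1))\<bar>"
        using N1 \<rho> by (simp only: abs_mult) simp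
      also have "\<dots> \<le> N1 / \<rho> * (x * (1 - x) * (\<alpha> * (\<rho> + 1) / N1 + K * (24 / N1\<^sup>2 + 8 / (real n)\<^sup>2)))"
        unfolding N1_def g_def using \<rho>
        by (intro mult_left_mono U_Taylor_remainder[OF \<rho> elim(2) C2_01_continuous[OF y2] x' K(1) K(2)[OF x]]) auto
      also have "\<dots> = (N1 / \<rho> * (\<alpha> * (\<rho> + 1) / N1) + \<delta> n) * (x * (1 - x))"
      proof -
        have "c * (p * (a + b)) = (c * a + c * b) * p" for a b c p :: real
          by algebra
        then show ?thesis
          unfolding \<delta>_def N1_def .
      qed
      also have "N1 / \<rho> * (\<alpha> * (\<rho> + 1) / N1) = e / 4"
        using N1 \<rho> by (simp add: \<alpha>_def divide_simps)
      finally show "\<bar>apply_C0 (?r n) x\<bar> \<le> (e / 4 + \<delta> n) * (x * (1 - x))" .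
    qed
    with elim(1) e show ?case by simp
  qed
qed

text \<open>Applying \<open>A_n\<close> to the Voronovskaja remainder \<open>r n\<close> gives, up
  to sign, the error to be estimated. The norms of \<open>A_n\<close> are at most 1, so the error
  tends to 0 with \<open>r n\<close>.\<close>

lemma A_n_A_op_tendsto:
  assumes \<rho>: "\<rho> > 0" and y: "y \<in> A_dom" and Y: "apply_C0 Y = y"
  shows "(\<lambda>n. blinfun_apply (A_n \<rho> n) (A_op \<rho> y)) \<longlonglongrightarrow> - Y"
proof -
  define r where "r n = ((real n * \<rho> + 1) / \<rho>) *\<^sub>R (blinfun_apply (U_C0 \<rho> n) Y - Y) - A_op \<rho> y" for n
  have "r \<longlonglongrightarrow> 0"
    unfolding r_def by (rule U_C0_Voronovskaja[OF assms])
  then have lim: "(\<lambda>n. norm (r n)) \<longlonglongrightarrow> 0"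
    by (rule tendsto_norm_zero)
  have "norm (blinfun_apply (A_n \<rho> n) (A_op \<rho> y) - (- Y)) \<le> norm (r n)" if n: "n \<ge> 1" for n
  proof -
    have N: "real n * \<rho> + 1 > 0" using \<rho> by (simp add: add_nonneg_pos)
    have "blinfun_apply (A_n \<rho> n) (blinfun_apply (U_C0 \<rho> n) Y - Y) =
        - blinfun_apply (A_n \<rho> n) (Y - blinfun_apply (U_C0 \<rho> n) Y)"
      by (simp add: blinfun.diff_right)
    also have "\<dots> = - ((\<rho> / (real n * \<rho> + 1)) *\<^sub>R Y)"
      by (simp only: A_n_minus_U_C0[OF \<rho> n])
    finally have "blinfun_apply (A_n \<rho> n) (blinfun_apply (U_C0 \<rho> n) Y - Y) = - ((\<rho> / (real n * \<rho> + 1)) *\<^sub>R Y)" .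
    then have "blinfun_apply (A_n \<rho> n) (r n) = - Y - blinfun_apply (A_n \<rho> n) (A_op \<rho> y)"
      using N \<rho> by (simp add: r_def blinfun.diff_right[of _ _ "A_op \<rho> y"] blinfun.scaleR_right)
    then have "norm (blinfun_apply (A_n \<rho> n) (A_op \<rho> y) - (- Y)) = norm (blinfun_apply (A_n \<rho> n) (r n))"
      by (simp only: norm_minus_commute)
    also have "\<dots> \<le> norm (A_n \<rho> n) * norm (r n)"
      by (rule norm_blinfun)
    also have "\<dots> \<le> 1 * norm (r n)"
    proof (rule mult_right_mono)
      have "\<rho> / (\<rho> + 1) \<le> 1" using \<rho> by simp
      with norm_A_n_le[OF \<rho> n] show "norm (A_n \<rho> n) \<le> 1" by (rule order.trans)
    qed simp
    finally show ?thesis by simp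
  qed
  then have "\<forall>\<^sub>F n in sequentially. norm (blinfun_apply (A_n \<rho> n) (A_op \<rho> y) - (- Y)) \<le> norm (r n)"
    by (auto simp: eventually_at_top_linorder)
  then have "(\<lambda>n. blinfun_apply (A_n \<rho> n) (A_op \<rho> y) - (- Y)) \<longlonglongrightarrow> 0"
    using lim by (rule Lim_null_comparison)
  then show ?thesis by (simp only: LIM_zero_iff)
qed

lemma A_op_inj:
  assumes "\<rho> > 0"
  shows "inj_on (A_op \<rho>) A_dom"
proof (rule inj_onI)
  fix y z assume y: "y \<in> A_dom" and z: "z \<in> A_dom" and eq: "A_op \<rho> y = A_op \<rho> z"
  obtain Y Z where YZ: "apply_C0 Y = y" "apply_C0 Z = z"
    using A_dom_in_C0 y z by metis
  have "- Y = - Z"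
    using A_n_A_op_tendsto[OF assms y YZ(1)] A_n_A_op_tendsto[OF assms z YZ(2)] unfolding eq
    by (rule LIMSEQ_unique)
  with YZ show "y = z" by auto
qed

theorem theorem5p1:
  fixes \<rho> :: real and f :: C0
  assumes "\<rho> > 0"
  shows "uniform_limit {0..1} (\<lambda>n x. apply_C0 (blinfun_apply (A_n \<rho> n) f) x)
           (\<lambda>x. - A_inv \<rho> f x) sequentially"
proof -
  obtain y where y: "y \<in> A_dom" "A_op \<rho> y = f"
    by (rule A_op_surj[OF assms])
  obtain Y where Y: "apply_C0 Y = y"
    by (rule A_dom_in_C0[OF y(1)])
  have inv: "A_inv \<rho> f = y"
    unfolding A_inv_def using the_inv_into_f_f[OF A_op_inj[OF assms] y(1)] y(2) by simp
  have lim: "(\<lambda>n. blinfun_apply (A_n \<rho> n) f) \<longlonglongrightarrow> - Y"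
    using A_n_A_op_tendsto[OF assms y(1) Y] y(2) by simp
  show ?thesis
  proof (rule uniform_limitI)
    fix e :: real assume "e > 0"
    with lim have "\<forall>\<^sub>F n in sequentially. dist (blinfun_apply (A_n \<rho> n) f) (- Y) < e"
      by (rule tendstoD)
    then show "\<forall>\<^sub>F n in sequentially. \<forall>x\<in>{0..1}. dist (apply_C0 (blinfun_apply (A_n \<rho> n) f) x) (- A_inv \<rho> f x) < e"
    proof eventually_elim
      case (elim n)
      show ?case
      proof
        fix x :: real assume x: "x \<in> {0..1}"
        have "dist (apply_C0 (blinfun_apply (A_n \<rho> n) f) x) (- A_inv \<rho> f x)
            = \<bar>apply_C0 (blinfun_apply (A_n \<rho> n) f - (- Y)) x\<bar>"
          by (simp add: inv dist_real_def plus_C0.rep_eq flip: Y)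
        \<comment> \<open>As \<open>x * (1 - x)\<close> is at most 1 on the interval, the norm of
          \<open>C0\<close> dominates the sup norm.\<close>
        also have "\<dots> \<le> norm (blinfun_apply (A_n \<rho> n) f - (- Y))"
          by (rule abs_apply_C0_le[OF x])
        finally show "dist (apply_C0 (blinfun_apply (A_n \<rho> n) f) x) (- A_inv \<rho> f x) < e"
          using elim unfolding dist_norm by linarith
      qed
    qed
  qed
qed

end
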